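(* Let $F\in\mathcal{A}_1(\mathbb{C}^2)$, $t>0$ and $\mathbf{x}\in\Omega$. Then for every $\alpha\in(0,\frac{\pi}{2})$ the limit $$\Psi_{D,N}(t,\mathbf{x};F)=\lim_{\varepsilon\to0^+}\int_\Omega e^{-\varepsilon|\mathbf{y}|^2}G_{D,N}(t,\mathbf{x},\mathbf{y})F(\mathbf{y})\,d\mathbf{y}$$ exists and equals the absolutely convergent integral $$\Psi_{D,N}(t,\mathbf{x};F)=e^{2i\alpha}\int_0^\infty\int_{-\frac{\pi}{2}}^{\frac{3\pi}{2}}G_{D,N}\big(t,\mathbf{x},\rho e^{i\alpha}(\cos\theta,\sin\theta)\big)\,F\big(\rho e^{i\alpha}(\cos\theta,\sin\theta)\big)\,\rho\,d\theta\,d\rho .$$ (This holds separately for the Dirichlet case $D$ and the Neumann case $N$.)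
   Context: Let $\Gamma=\{(0,x_2):x_2\le0\}\subset\mathbb{R}^2$ and $\Omega=\mathbb{R}^2\setminus\Gamma$. Every $\mathbf{x}\in\Omega$ is written in polar coordinates $\mathbf{x}=r(\cos\varphi,\sin\varphi)$ with $r>0$, $\varphi\in(-\frac{\pi}{2},\frac{3\pi}{2})$. $\mathcal{A}_1(\mathbb{C}^2)$ denotes the space of entire functions $F:\mathbb{C}^2\to\mathbb{C}$ for which there exist $A,B\ge0$ with $|F(\mathbf{z})|\le Ae^{B|\mathbf{z}|}$ for all $\mathbf{z}\in\mathbb{C}^2$; here $|\mathbf{z}|=\sqrt{|z_1|^2+|z_2|^2}$. Let $\Lambda(z)=\frac{2}{\sqrt{\pi}}\int_0^\infty e^{-s^2-2zs}ds$ for $z\in\mathbb{C}$ (an entire function). For $t>0$, $\mathbf{x}=r(\cos\varphi,\sin\varphi)\in\Omega$, $w\in\mathbb{C}$ with $\Re w>0$ and $\theta\in(-\frac{\pi}{2},\frac{3\pi}{2})$, define $$G_{D,N}\big(t,\mathbf{x},w(\cos\theta,\sin\theta)\big)=\frac{e^{-\frac{(r+w)^2}{4it}}}{8i\pi t}\Big(\Lambda\Big(\tfrac{\sqrt{rw}\cos(\frac{\varphi-\theta}{2})}{\sqrt{it}}\Big)\mp\Lambda\Big(-\tfrac{\sqrt{rw}\sin(\frac{\varphi+\theta}{2})}{\sqrt{it}}\Big)\Big),$$ with principal square roots, the sign $-$ for $G_D$ (Dirichlet) and $+$ for $G_N$ (Neumann). For real $w=\rho>0$ this is the Green's function of the time-dependent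 Schrödinger equation $i\partial_t\Psi=-\Delta\Psi$ on $\Omega$ with Dirichlet ($\Psi=0$) resp. Neumann ($\partial_{x_1}\Psi=0$) boundary condition on $\Gamma$, evaluated at $\mathbf{y}=\rho(\cos\theta,\sin\theta)\in\Omega$. *)

theory Defs
  imports "HOL-Analysis.Analysis"
begin

definition entire2 :: "(complex \<times> complex \<Rightarrow> complex) \<Rightarrow> bool" where
  "entire2 F \<longleftrightarrow>
     (\<forall>z. \<exists>a b::complex. (F has_derivative (\<lambda>h. a * fst h + b * snd h)) (at z))"

text \<open>The class A_1(C^2): entire functions of exponential type. The norm on
  complex \<times> complex is sqrt(|z1|^2+|z2|^2).\<close>
definition A1 :: "(complex \<times> complex \<Rightarrow> complex) set" where
  "A1 = {F. entire2 F \<and>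
            (\<exists>A B::real. A \<ge> 0 \<and> B \<ge> 0 \<and> (\<forall>z. norm (F z) \<le> A * exp (B * norm z)))}"

definition Omega :: "(real \<times> real) set" where
  "Omega = UNIV - {p. fst p = 0 \<and> snd p \<le> 0}"

text \<open>Polar angle in (-pi/2, 3pi/2) of a point of Omega.\<close>
definition polar_angle :: "real \<times> real \<Rightarrow> real" where
  "polar_angle p = (let a = Arg (Complex (fst p) (snd p)) in
                    if a < - pi / 2 then a + 2 * pi else a)"

definition Lambda :: "complex \<Rightarrow> complex" where
  "Lambda z = complex_of_real (2 / sqrt pi) *
     set_lebesgue_integral lborel {0::real..}
       (\<lambda>s. exp (complex_of_real (- (s ^ 2)) - 2 * z * complex_of_real s))"

text \<open>Green's function G_{D,N}(t, x, w(cos theta, sin theta)) with x = r(cos phi, sin phi).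
  dir = True: Dirichlet (sign -); dir = False: Neumann (sign +).\<close>
definition Gpolar :: "bool \<Rightarrow> real \<Rightarrow> real \<Rightarrow> real \<Rightarrow> complex \<Rightarrow> real \<Rightarrow> complex" where
  "Gpolar dir t r \<phi> w \<theta> =
     exp (- ((complex_of_real r + w) ^ 2) / (4 * \<i> * complex_of_real t))
       / (8 * \<i> * complex_of_real pi * complex_of_real t)
     * (Lambda (csqrt (complex_of_real r * w) * complex_of_real (cos ((\<phi> - \<theta>) / 2))
                 / csqrt (\<i> * complex_of_real t))
        + (if dir then -1 else 1) *
          Lambda (- csqrt (complex_of_real r * w) * complex_of_real (sin ((\<phi> + \<theta>) / 2))
                 / csqrt (\<i> * complex_of_real t)))"

definition G :: "bool \<Rightarrow> real \<Rightarrow> real \<times> real \<Rightarrow> real \<times> real \<Rightarrow> complex" where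
  "G dir t x y = Gpolar dir t (norm x) (polar_angle x) (complex_of_real (norm y)) (polar_angle y)"

definition cpair :: "real \<times> real \<Rightarrow> complex \<times> complex" where
  "cpair y = (complex_of_real (fst y), complex_of_real (snd y))"

definition rotated_integrand ::
  "bool \<Rightarrow> real \<Rightarrow> real \<times> real \<Rightarrow> (complex \<times> complex \<Rightarrow> complex) \<Rightarrow> real \<Rightarrow> real \<times> real \<Rightarrow> complex" where
  "rotated_integrand dir t x F \<alpha> q =
     (let \<rho> = fst q; \<theta> = snd q; w = complex_of_real \<rho> * exp (\<i> * complex_of_real \<alpha>) in
      Gpolar dir t (norm x) (polar_angle x) w \<theta>
      * F (w * complex_of_real (cos \<theta>), w * complex_of_real (sin \<theta>))
      * complex_of_real \<rho>)"

end

theory Submission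
  imports Defs "HOL-Complex_Analysis.Complex_Analysis"
begin

text \<open>In polar coordinates the regularised integral is an integral over \<open>\<theta>\<close> of one-dimensional
  integrals over \<open>\<rho> > 0\<close> whose integrand extends holomorphically to \<open>Re w > 0\<close>. The trivial bound
  \<open>\<bar>\<Lambda> z\<bar> \<le> K exp (2 \<bar>z\<bar>\<^sup>2)\<close> already makes the \<open>\<Lambda>\<close>-factors at most exponential in \<open>\<bar>w\<bar>\<close>, because their
  arguments are of size \<open>sqrt \<bar>w\<bar>\<close>. Hence for small \<open>\<epsilon>\<close> the Gaussian factor
  \<open>exp (- \<epsilon> w\<^sup>2 + \<i> w\<^sup>2 / (4 t))\<close> dominates in the whole sector \<open>0 \<le> arg w \<le> \<alpha>\<close>, so the ray can be rotated by
  Cauchy's theorem. On the rotated ray the factor decays uniformly in \<open>\<epsilon>\<close>, and dominated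
  convergence gives the limit.\<close>

section \<open>Polar coordinates for Lebesgue measure on the plane\<close>

lemma UN_tan_intervals: "(\<Union>n::nat. {- arctan (real n)..arctan (real n)}) = {-pi/2<..<pi/2}"
proof (intro set_eqI iffI)
  fix x assume "x \<in> (\<Union>n::nat. {- arctan (real n)..arctan (real n)})"
  then obtain n :: nat where "- arctan (real n) \<le> x" "x \<le> arctan (real n)" by auto
  with arctan_ubound[of "real n"] show "x \<in> {-pi/2<..<pi/2}" by auto
next
  fix x assume "x \<in> {-pi/2<..<pi/2}"
  then have x: "- (pi/2) < x" "x < pi/2" by auto
  obtain n :: nat where "\<bar>tan x\<bar> \<le> real n" using real_arch_simple by blast
  then have "tan x \<le> real n" "- real n \<le> tan x" by linarith+
  then have "arctan (tan x) \<le> arctan (real n)" "arctan (- real n) \<le> arctan (tan x)"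
    by (auto simp: arctan_le_iff)
  then show "x \<in> (\<Union>n::nat. {- arctan (real n)..arctan (real n)})"
    using x by (auto simp: arctan_tan arctan_minus)
qed

text \<open>The substitution rule for compact intervals applies to
  \<open>- arctan n..arctan n\<close>, which \<open>tan\<close> maps onto \<open>- n..n\<close>.
  Both sides, read as measures with densities \<open>f\<close> and \<open>g\<close>, then pass to
  the union by continuity from below.\<close>

lemma nn_integral_substitution_tan:
  fixes f :: "real \<Rightarrow> real"
  assumes [measurable]: "f \<in> borel_measurable borel" and nn: "\<And>x. 0 \<le> f x"
  shows "(\<integral>\<^sup>+x. ennreal (f x) \<partial>lborel) =
    (\<integral>\<^sup>+\<theta>. ennreal (f (tan \<theta>) * inverse ((cos \<theta>)\<^sup>2)) * indicator {-pi/2<..<pi/2} \<theta> \<partial>lborel)"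
proof -
  define A where "A = (\<lambda>n::nat. {- real n..real n})"
  define B where "B = (\<lambda>n::nat. {- arctan (real n)..arctan (real n)})"
  have A: "incseq A" "(\<Union>n. A n) = UNIV"
  proof -
    show "incseq A" by (auto simp: A_def incseq_def)
    have "\<exists>n. x \<in> A n" for x
      using real_arch_simple[of "\<bar>x\<bar>"] unfolding A_def atLeastAtMost_iff
      by (metis abs_le_iff minus_le_iff)
    then show "(\<Union>n. A n) = UNIV" by auto
  qed
  have B: "incseq B" "(\<Union>n. B n) = {-pi/2<..<pi/2}"
  proof -
    have "arctan (real m) \<le> arctan (real n)" if "m \<le> n" for m n
      using that by (simp add: arctan_le_iff)
    then show "incseq B" unfolding B_def incseq_def by fastforce
    show "(\<Union>n. B n) = {-pi/2<..<pi/2}" using UN_tan_intervals by (simp add: B_def)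
  qed
  define g where "g = (\<lambda>\<theta>. f (tan \<theta>) * inverse ((cos \<theta>)\<^sup>2))"
  have [measurable]: "(tan :: real \<Rightarrow> real) \<in> borel_measurable borel"
    unfolding tan_def by measurable
  have g[measurable]: "g \<in> borel_measurable borel" unfolding g_def by measurable
  have eq: "(\<integral>\<^sup>+x. ennreal (f x) * indicator (A n) x \<partial>lborel)
      = (\<integral>\<^sup>+x. ennreal (g x) * indicator (B n) x \<partial>lborel)" for n
  proof -
    have c: "cos x \<noteq> 0" if "x \<in> B n" for x
    proof -
      have "x \<in> {-pi/2<..<pi/2}" using that B by auto
      then show ?thesis using cos_gt_zero_pi[of x] by auto
    qed
    have tm: "tan (- arctan (real n)) = - real n" by (simp add: tan_arctan)
    have "(\<integral>\<^sup>+x. ennreal (f x * indicator {tan (- arctan (real n))..tan (arctan (real n))} x) \<partial>lborel)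
      = (\<integral>\<^sup>+x. ennreal (f (tan x) * inverse ((cos x)\<^sup>2) * indicator {- arctan (real n)..arctan (real n)} x) \<partial>lborel)"
    proof (rule nn_integral_substitution)
      show "set_borel_measurable borel {tan (- arctan (real n))..tan (arctan (real n))} f"
        unfolding set_borel_measurable_def by measurable
      show "(tan has_real_derivative inverse ((cos x)\<^sup>2)) (at x)" 
        if "x \<in> {- arctan (real n)..arctan (real n)}" for x
        using c that by (auto simp: B_def intro!: DERIV_tan)
      show "continuous_on {- arctan (real n)..arctan (real n)} (\<lambda>x. inverse ((cos x)\<^sup>2))"
        using c by (auto simp: B_def intro!: continuous_intros)
    qed auto
    then show ?thesis
      unfolding tm by (auto simp: A_def B_def g_def tan_arctan ennreal_mult' ennreal_indicator nn
        intro!: nn_integral_cong)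
  qed
  have "(\<integral>\<^sup>+x. ennreal (f x) \<partial>lborel) = emeasure (density lborel (\<lambda>x. ennreal (f x))) (\<Union>n. A n)"
    unfolding A by (subst emeasure_density) (auto)
  also have "\<dots> = (SUP n. emeasure (density lborel (\<lambda>x. ennreal (f x))) (A n))"
    by (intro SUP_emeasure_incseq[symmetric] A) (auto simp: A_def)
  also have "\<dots> = (SUP n. emeasure (density lborel (\<lambda>x. ennreal (g x))) (B n))"
  proof (intro SUP_cong refl)
    fix n
    have "A n \<in> sets lborel" "B n \<in> sets lborel" by (auto simp: A_def B_def)
    then show "emeasure (density lborel (\<lambda>x. ennreal (f x))) (A n) = 
        emeasure (density lborel (\<lambda>x. ennreal (g x))) (B n)"
      by (simp add: emeasure_density eq)
  qed
  also have "\<dots> = emeasure (density lborel (\<lambda>x. ennreal (g x))) (\<Union>n. B n)"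
    by (intro SUP_emeasure_incseq B) (auto simp: B_def)
  finally show ?thesis unfolding B by (subst (asm) emeasure_density) (auto simp: g_def)
qed

text \<open>The angular window is open at \<open>- pi / 2\<close>, the direction of the slit, so
  \<open>polar_pt\<close> maps this set bijectively onto \<open>Omega\<close> and \<open>snd\<close>
  agrees with \<open>polar_angle\<close> there.\<close>

definition polar_dom :: "(real \<times> real) set" where
  "polar_dom = {0<..} \<times> {- pi / 2 <..< 3 * pi / 2}"

definition polar_pt :: "real \<times> real \<Rightarrow> real \<times> real" where
  "polar_pt q = (fst q * cos (snd q), fst q * sin (snd q))"

lemma measurable_polar_pt [measurable]: "polar_pt \<in> borel_measurable borel"
  unfolding polar_pt_def by (intro borel_measurable_continuous_onI continuous_intros)

lemma polar_dom_sets [measurable]: "polar_dom \<in> sets borel"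
  unfolding polar_dom_def by (intro borel_open open_Times) auto

lemma measurable_fst_borel [measurable]: "fst \<in> borel_measurable (borel :: (real \<times> real) measure)"
  by (intro borel_measurable_continuous_onI continuous_intros)

text \<open>Only one-dimensional substitutions are needed: \<open>y = x tan \<theta>\<close> and \<open>x = \<rho> cos \<theta>\<close>
  with \<open>\<theta>\<close> in \<open>(-\<pi>/2, \<pi>/2)\<close> and \<open>\<rho>\<close> of either sign; the half \<open>\<rho> < 0\<close> is then
  reflected to \<open>(-\<rho>, \<theta> + \<pi>)\<close>.\<close>
lemma emeasure_lborel_polar:
  assumes [measurable]: "A \<in> sets (borel :: (real \<times> real) measure)"
  shows "emeasure lborel A = 
    (\<integral>\<^sup>+q. ennreal (indicator polar_dom q * fst q) * indicator A (polar_pt q) \<partial>lborel)"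
proof -
  let ?a = "\<lambda>x y. indicator A (x, y) :: real"
  define I where "I = {-pi/2<..<pi/2}"
  have [measurable]: "I \<in> sets borel" by (simp add: I_def)
  have [measurable]: "(tan :: real \<Rightarrow> real) \<in> borel_measurable borel"
    unfolding tan_def by measurable
  let ?k = "\<lambda>\<rho> \<theta>. ennreal (\<bar>\<rho>\<bar> * ?a (\<rho> * cos \<theta>) (\<rho> * sin \<theta>))"
  have "emeasure lborel A = (\<integral>\<^sup>+q. indicator A q \<partial>(lborel \<Otimes>\<^sub>M lborel))"
    by (simp add: lborel_prod)
  also have "\<dots> = (\<integral>\<^sup>+x. (\<integral>\<^sup>+y. indicator A (x, y) \<partial>lborel) \<partial>lborel)"
    by (subst lborel.nn_integral_fst[symmetric]) (auto simp: lborel_prod)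
  also have "\<dots> = (\<integral>\<^sup>+x. (\<integral>\<^sup>+\<theta>. ennreal (\<bar>x\<bar> * ?a x (x * tan \<theta>) * inverse ((cos \<theta>)\<^sup>2)) * indicator I \<theta> \<partial>lborel) \<partial>lborel)"
  proof (rule nn_integral_cong_AE, rule AE_mp[OF AE_lborel_singleton[of 0]], rule AE_I2, rule impI)
    \<comment> \<open>The scaling of \<open>y\<close> by \<open>x\<close> degenerates on the line
      \<open>x = 0\<close>, which is discarded as a null set.\<close>
    fix x :: real assume x: "x \<noteq> 0"
    have "(\<integral>\<^sup>+y. indicator A (x, y) \<partial>lborel) = ennreal \<bar>x\<bar> * (\<integral>\<^sup>+y. indicator A (x, 0 + x * y) \<partial>lborel)"
      by (rule nn_integral_real_affine[OF _ x]) simp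
    also have "\<dots> = (\<integral>\<^sup>+y. ennreal (\<bar>x\<bar> * ?a x (x * y)) \<partial>lborel)"
      by (simp add: nn_integral_cmult[symmetric] ennreal_mult' ennreal_indicator)
    also have "\<dots> = (\<integral>\<^sup>+\<theta>. ennreal (\<bar>x\<bar> * ?a x (x * tan \<theta>) * inverse ((cos \<theta>)\<^sup>2)) * indicator I \<theta> \<partial>lborel)"
      unfolding I_def by (rule nn_integral_substitution_tan) auto
    finally show "(\<integral>\<^sup>+y. indicator A (x, y) \<partial>lborel) = 
      (\<integral>\<^sup>+\<theta>. ennreal (\<bar>x\<bar> * ?a x (x * tan \<theta>) * inverse ((cos \<theta>)\<^sup>2)) * indicator I \<theta> \<partial>lborel)" .
  qed
  also have "\<dots> = (\<integral>\<^sup>+\<theta>. (\<integral>\<^sup>+x. ennreal (\<bar>x\<bar> * ?a x (x * tan \<theta>) * inverse ((cos \<theta>)\<^sup>2)) * indicator I \<theta> \<partial>lborel) \<partial>lborel)"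
    by (rule lborel_pair.Fubini') measurable
  also have "\<dots> = (\<integral>\<^sup>+\<theta>. indicator I \<theta> * (\<integral>\<^sup>+\<rho>. ?k \<rho> \<theta> \<partial>lborel) \<partial>lborel)"
  proof (intro nn_integral_cong)
    fix \<theta> :: real
    show "(\<integral>\<^sup>+x. ennreal (\<bar>x\<bar> * ?a x (x * tan \<theta>) * inverse ((cos \<theta>)\<^sup>2)) * indicator I \<theta> \<partial>lborel)
      = indicator I \<theta> * (\<integral>\<^sup>+\<rho>. ?k \<rho> \<theta> \<partial>lborel)"
    proof (cases "\<theta> \<in> I")
      case True
      then have c: "cos \<theta> > 0" using cos_gt_zero_pi[of \<theta>] by (auto simp: I_def)
      have "(\<integral>\<^sup>+x. ennreal (\<bar>x\<bar> * ?a x (x * tan \<theta>) * inverse ((cos \<theta>)\<^sup>2)) \<partial>lborel)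
        = ennreal \<bar>cos \<theta>\<bar> * (\<integral>\<^sup>+x. ennreal (\<bar>0 + cos \<theta> * x\<bar> * ?a (0 + cos \<theta> * x) ((0 + cos \<theta> * x) * tan \<theta>) * inverse ((cos \<theta>)\<^sup>2)) \<partial>lborel)"
        by (rule nn_integral_real_affine) (use c in auto)
      also have "\<dots> = (\<integral>\<^sup>+x. ennreal \<bar>cos \<theta>\<bar> * ennreal (\<bar>0 + cos \<theta> * x\<bar> * ?a (0 + cos \<theta> * x) ((0 + cos \<theta> * x) * tan \<theta>) * inverse ((cos \<theta>)\<^sup>2)) \<partial>lborel)"
        by (subst nn_integral_cmult) measurable
      also have "\<dots> = (\<integral>\<^sup>+\<rho>. ?k \<rho> \<theta> \<partial>lborel)"
      proof (intro nn_integral_cong)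
        fix x :: real
        \<comment> \<open>One factor \<open>cos \<theta>\<close> comes from the scaling and one from
          the old weight. Together they cancel the inverse square produced by \<open>tan\<close> and
          leave the polar weight.\<close>
        have "cos \<theta> * tan \<theta> = sin \<theta>" using c by (simp add: tan_def)
        then show "ennreal \<bar>cos \<theta>\<bar> * ennreal (\<bar>0 + cos \<theta> * x\<bar> * ?a (0 + cos \<theta> * x) ((0 + cos \<theta> * x) * tan \<theta>) * inverse ((cos \<theta>)\<^sup>2)) = ?k x \<theta>"
          using c by (simp add: ennreal_mult'[symmetric] abs_mult power2_eq_square field_simps)
      qed
      finally show ?thesis using True by simp
    qed simp
  qed
  also have "\<dots> = (\<integral>\<^sup>+\<theta>. indicator I \<theta> * (\<integral>\<^sup>+\<rho>. indicator {0<..} \<rho> * ?k \<rho> \<theta> \<partial>lborel) \<partial>lborel)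
      + (\<integral>\<^sup>+\<theta>. indicator I \<theta> * (\<integral>\<^sup>+\<rho>. indicator {..<0} \<rho> * ?k \<rho> \<theta> \<partial>lborel) \<partial>lborel)"
  proof -
    have "(\<integral>\<^sup>+\<rho>. ?k \<rho> \<theta> \<partial>lborel) = (\<integral>\<^sup>+\<rho>. indicator {0<..} \<rho> * ?k \<rho> \<theta> \<partial>lborel) + 
      (\<integral>\<^sup>+\<rho>. indicator {..<0} \<rho> * ?k \<rho> \<theta> \<partial>lborel)" for \<theta>
      by (subst nn_integral_add[symmetric]) (auto intro!: nn_integral_cong split: split_indicator)
    then show ?thesis
      by (simp add: distrib_left) (subst nn_integral_add, auto)
  qed
  also have "(\<integral>\<^sup>+\<theta>. indicator I \<theta> * (\<integral>\<^sup>+\<rho>. indicator {..<0} \<rho> * ?k \<rho> \<theta> \<partial>lborel) \<partial>lborel)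
     = (\<integral>\<^sup>+\<theta>. indicator {pi/2<..<3*pi/2} \<theta> * (\<integral>\<^sup>+\<rho>. indicator {0<..} \<rho> * ?k \<rho> \<theta> \<partial>lborel) \<partial>lborel)"
  proof -
    have "(\<integral>\<^sup>+\<rho>. indicator {0<..} \<rho> * ?k \<rho> \<theta> \<partial>lborel) =
      (\<integral>\<^sup>+\<rho>. indicator {..<0} \<rho> * ?k \<rho> (\<theta> - pi) \<partial>lborel)" for \<theta>
      by (subst nn_integral_real_affine[where c="-1" and t=0])
        (auto intro!: nn_integral_cong simp: cos_diff sin_diff split: split_indicator)
    then have "(\<integral>\<^sup>+\<theta>. indicator {pi/2<..<3*pi/2} \<theta> * (\<integral>\<^sup>+\<rho>. indicator {0<..} \<rho> * ?k \<rho> \<theta> \<partial>lborel) \<partial>lborel)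
      = (\<integral>\<^sup>+\<theta>. indicator {pi/2<..<3*pi/2} \<theta> * (\<integral>\<^sup>+\<rho>. indicator {..<0} \<rho> * ?k \<rho> (\<theta> - pi) \<partial>lborel) \<partial>lborel)"
      by simp
    also have "\<dots> = (\<integral>\<^sup>+\<theta>. indicator I \<theta> * (\<integral>\<^sup>+\<rho>. indicator {..<0} \<rho> * ?k \<rho> \<theta> \<partial>lborel) \<partial>lborel)"
      by (subst nn_integral_real_affine[where c=1 and t=pi])
        (auto intro!: nn_integral_cong simp: I_def split: split_indicator)
    finally show ?thesis ..
  qed
  also have "(\<integral>\<^sup>+\<theta>. indicator I \<theta> * (\<integral>\<^sup>+\<rho>. indicator {0<..} \<rho> * ?k \<rho> \<theta> \<partial>lborel) \<partial>lborel) + \<dots>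
     = (\<integral>\<^sup>+\<theta>. indicator {-pi/2<..<3*pi/2} \<theta> * (\<integral>\<^sup>+\<rho>. indicator {0<..} \<rho> * ?k \<rho> \<theta> \<partial>lborel) \<partial>lborel)"
  proof (subst nn_integral_add[symmetric])
    \<comment> \<open>The right half-plane and the reflected left one use disjoint angular ranges,
      which miss only the null set \<open>\<theta> = pi / 2\<close> of the window.\<close>
    have "indicator I \<theta> * X + indicator {pi/2<..<3*pi/2} \<theta> * X = indicator {-pi/2<..<3*pi/2} \<theta> * X"
      if "\<theta> \<noteq> pi / 2" for \<theta> and X :: ennreal
    proof -
      have "0 < pi" by simp
      with that have "\<theta> \<in> {-pi/2<..<3*pi/2} \<longleftrightarrow> \<theta> \<in> I \<or> \<theta> \<in> {pi/2<..<3*pi/2}" 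
        "\<not> (\<theta> \<in> I \<and> \<theta> \<in> {pi/2<..<3*pi/2})"
        by (auto simp: I_def)
      then show ?thesis unfolding indicator_def by (auto simp del: greaterThanLessThan_iff)
    qed
    then show "(\<integral>\<^sup>+\<theta>. indicator I \<theta> * (\<integral>\<^sup>+\<rho>. indicator {0<..} \<rho> * ?k \<rho> \<theta> \<partial>lborel) + 
        indicator {pi/2<..<3*pi/2} \<theta> * (\<integral>\<^sup>+\<rho>. indicator {0<..} \<rho> * ?k \<rho> \<theta> \<partial>lborel) \<partial>lborel)
      = (\<integral>\<^sup>+\<theta>. indicator {-pi/2<..<3*pi/2} \<theta> * (\<integral>\<^sup>+\<rho>. indicator {0<..} \<rho> * ?k \<rho> \<theta> \<partial>lborel) \<partial>lborel)"
      by - (rule nn_integral_cong_AE, rule AE_mp[OF AE_lborel_singleton[of "pi/2"]], rule AE_I2, rule impI)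
  qed measurable
  also have "\<dots> = (\<integral>\<^sup>+\<theta>. (\<integral>\<^sup>+\<rho>. ennreal (indicator polar_dom (\<rho>, \<theta>) * \<rho>) * indicator A (polar_pt (\<rho>, \<theta>)) \<partial>lborel) \<partial>lborel)"
    by (subst nn_integral_cmult[symmetric])
      (auto intro!: nn_integral_cong simp: polar_pt_def polar_dom_def split: split_indicator)
  also have "\<dots> = (\<integral>\<^sup>+q. ennreal (indicator polar_dom q * fst q) * indicator A (polar_pt q) \<partial>(lborel \<Otimes>\<^sub>M lborel))"
    by (subst lborel_pair.nn_integral_snd[symmetric]) (auto simp: lborel_prod)
  finally show ?thesis by (simp add: lborel_prod)
qed

text \<open>Stated as an equality of measures, the change of variables passes to Bochner integrals
  through the rules for \<open>distr\<close> and \<open>density\<close>, for integrability and value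
  alike.\<close>

lemma lborel_eq_polar:
  "lborel = distr (density lborel (\<lambda>q. ennreal (indicator polar_dom q * fst q))) borel polar_pt"
  (is "_ = distr ?D _ _")
proof (rule measure_eqI)
  fix A assume "A \<in> sets (lborel :: (real \<times> real) measure)"
  then have [measurable]: "A \<in> sets borel" by simp
  have "emeasure (distr ?D borel polar_pt) A = emeasure ?D (polar_pt -` A)"
    by (subst emeasure_distr) (auto)
  also have "\<dots> = (\<integral>\<^sup>+q. ennreal (indicator polar_dom q * fst q) * indicator (polar_pt -` A) q \<partial>lborel)"
    by (rule emeasure_density) (auto intro: measurable_sets_borel[OF measurable_polar_pt])
  finally show "emeasure lborel A = emeasure (distr ?D borel polar_pt) A"
    by (simp add: emeasure_lborel_polar indicator_vimage[abs_def] comp_def)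
qed simp

lemma polar_integral:
  fixes f :: "real \<times> real \<Rightarrow> 'a::{banach, second_countable_topology}"
  assumes [measurable]: "f \<in> borel_measurable borel"
  shows "integrable lborel f \<longleftrightarrow> set_integrable lborel polar_dom (\<lambda>q. fst q *\<^sub>R f (polar_pt q))"
    and "(LINT y|lborel. f y) = (LINT q:polar_dom|lborel. fst q *\<^sub>R f (polar_pt q))"
proof -
  let ?d = "\<lambda>q::real \<times> real. indicator polar_dom q * fst q"
  have d: "?d \<in> borel_measurable lborel" "\<And>q. 0 \<le> ?d q"
    by (measurable, auto simp: polar_dom_def split: split_indicator)
  have f: "(\<lambda>q. f (polar_pt q)) \<in> borel_measurable lborel" by simp
  show "integrable lborel f \<longleftrightarrow> set_integrable lborel polar_dom (\<lambda>q. fst q *\<^sub>R f (polar_pt q))"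
    by (subst lborel_eq_polar, subst integrable_distr_eq)
      (use d f in \<open>auto simp: integrable_density set_integrable_def\<close>)
  show "(LINT y|lborel. f y) = (LINT q:polar_dom|lborel. fst q *\<^sub>R f (polar_pt q))"
    by (subst lborel_eq_polar, subst integral_distr)
      (use d f in \<open>auto simp: integral_density set_lebesgue_integral_def\<close>)
qed

section \<open>Growth and holomorphy of \<open>Lambda\<close>\<close>

lemma set_integrable_exp_minus: "set_integrable lborel {0..} (\<lambda>s::real. exp (- s))"
proof -
  have "(\<integral>\<^sup>+x. ennreal (exp (- x)) * indicator {0..} x \<partial>lborel) = ennreal (0 - (- exp (- 0)))"
  proof (rule nn_integral_FTC_atLeast)
    show "((\<lambda>x::real. - exp (- x)) \<longlongrightarrow> 0) at_top"
      using tendsto_minus[OF exp_at_bot[THEN filterlim_compose, OF filterlim_uminus_at_bot_at_top]] by simp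
  qed (auto intro!: derivative_eq_intros)
  moreover have "(\<integral>\<^sup>+x. ennreal (indicat_real {0..} x *\<^sub>R exp (- x)) \<partial>lborel)
      = (\<integral>\<^sup>+x. ennreal (exp (- x)) * indicator {0..} x \<partial>lborel)"
    by (auto intro!: nn_integral_cong split: split_indicator)
  ultimately show ?thesis
    unfolding set_integrable_def by (intro integrableI_nonneg) auto
qed

text \<open>Half of \<open>(s - 2 * norm z)^2 \<ge> 0\<close> plus half of
  \<open>(s - 1)^2 \<ge> 0\<close> gives the bound. It separates \<open>z\<close> from
  \<open>s\<close>, so one majorant \<open>exp (- s)\<close> controls integrability, the growth of
  \<open>Lambda\<close> and the tails of its integral.\<close>

lemma Lambda_integrand_le:
  assumes "0 \<le> s"
  shows "norm (exp (complex_of_real (- (s ^ 2)) - 2 * z * complex_of_real s))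
    \<le> exp (2 * (norm z)\<^sup>2 + 1/2) * exp (- s)"
proof -
  have "- Re z * s \<le> norm z * s"
    using assms complex_Re_le_cmod[of "-z"] by (intro mult_right_mono) auto
  moreover have "0 \<le> (s - 2 * norm z)\<^sup>2" "0 \<le> (s - 1)\<^sup>2" by auto
  ultimately have "- (s^2) - 2 * (Re z * s) \<le> 2 * (norm z)\<^sup>2 + 1/2 - s"
    by (simp add: power2_eq_square algebra_simps)
  then show ?thesis by (simp add: norm_exp_eq_Re exp_add[symmetric] power2_eq_square algebra_simps)
qed

lemma set_integrable_Lambda:
  "set_integrable lborel {0..} (\<lambda>s. exp (complex_of_real (- (s ^ 2)) - 2 * z * complex_of_real s))"
proof (rule set_integrable_bound)
  show "set_integrable lborel {0..} (\<lambda>s::real. exp (2 * (norm z)\<^sup>2 + 1/2) * exp (- s))"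
    using set_integrable_exp_minus by simp
  show "set_borel_measurable lborel {0..} (\<lambda>s. exp (complex_of_real (- (s ^ 2)) - 2 * z * complex_of_real s))"
    unfolding set_borel_measurable_def by measurable
qed (use Lambda_integrand_le[of _ z] in auto)

lemma Lambda_le:
  obtains K where "0 \<le> K" "\<And>z. norm (Lambda z) \<le> K * exp (2 * (norm z)\<^sup>2)"
proof
  let ?K = "2 / sqrt pi * (exp (1/2) * (LINT s:{0..}|lborel. exp (- s)))"
  have nn: "0 \<le> (LINT s:{0::real..}|lborel. exp (- s))"
    unfolding set_lebesgue_integral_def by (rule Bochner_Integration.integral_nonneg) auto
  then show "0 \<le> ?K" by simp
  fix z
  have "norm (LINT s:{0..}|lborel. exp (complex_of_real (- (s ^ 2)) - 2 * z * complex_of_real s))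
    \<le> (LINT s:{0..}|lborel. norm (exp (complex_of_real (- (s ^ 2)) - 2 * z * complex_of_real s)))"
    by (rule set_integral_norm_bound[OF set_integrable_Lambda])
  also have "\<dots> \<le> (LINT s:{0..}|lborel. exp (2 * (norm z)\<^sup>2 + 1/2) * exp (- s))"
    by (rule set_integral_mono[OF set_integrable_norm[OF set_integrable_Lambda]])
      (use set_integrable_exp_minus Lambda_integrand_le[of _ z] in auto)
  also have "\<dots> = exp (2 * (norm z)\<^sup>2) * (exp (1/2) * (LINT s:{0..}|lborel. exp (- s)))"
    by (simp add: exp_add)
  finally show "norm (Lambda z) \<le> ?K * exp (2 * (norm z)\<^sup>2)"
    unfolding Lambda_def by (simp add: norm_mult norm_divide divide_right_mono mult_ac)
qed

text \<open>The integral cut off at \<open>n\<close> is holomorphic by differentiation under the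
  integral sign. The remainder is at most a locally bounded function of \<open>z\<close> times the
  tail of the integral of \<open>exp (- s)\<close>, so the cut-offs converge uniformly on
  discs.\<close>

lemma Lambda_holomorphic: "Lambda holomorphic_on UNIV"
proof -
  define k where "k = (\<lambda>z s. exp (complex_of_real (- (s ^ 2)) - 2 * z * complex_of_real s))"
  define f where "f = (\<lambda>(n::nat) z. LINT s:{0..real n}|lborel. k z s)"
  define g where "g = (\<lambda>z. LINT s:{0..}|lborel. k z s)"
  define L where "L = (\<lambda>n::nat. LINT s:{0..real n}|lborel. exp (- s))"
  have int: "set_integrable lborel {0..} (k z)" for z
    unfolding k_def by (rule set_integrable_Lambda)
  have U: "(\<Union>n::nat. {0..real n}) = {0..}"
    using real_arch_simple by auto
  have lim: "(\<lambda>n. (LINT s:{0..}|lborel. exp (- s)) - L n) \<longlonglongrightarrow> 0"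
  proof -
    have "L \<longlonglongrightarrow> (LINT s:(\<Union>n::nat. {0..real n})|lborel. exp (- s))"
      unfolding L_def
      by (rule set_integral_cont_up) (use set_integrable_exp_minus U in \<open>auto simp: incseq_def\<close>)
    from tendsto_diff[OF tendsto_const[of "LINT s:{0..}|lborel. exp (- s)"] this] show ?thesis
      unfolding U by simp
  qed
  have fg: "norm (f n z - g z) \<le> exp (2 * (norm z)\<^sup>2 + 1/2) * ((LINT s:{0..}|lborel. exp (- s)) - L n)" for n z
  proof -
    have split: "{0..} = {0..real n} \<union> {real n<..}" by auto
    have i: "set_integrable lborel {real n<..} (k z)" "set_integrable lborel {0..real n} (k z)"
      by (rule set_integrable_subset[OF int]; force)+
    have ie: "set_integrable lborel {real n<..} (\<lambda>s. exp (- s))" "set_integrable lborel {0..real n} (\<lambda>s. exp (- s))"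
      by (rule set_integrable_subset[OF set_integrable_exp_minus]; force)+
    have "g z = f n z + (LINT s:{real n<..}|lborel. k z s)"
      unfolding g_def f_def split by (rule set_integral_Un[OF _ i(2,1)]) auto
    then have "norm (f n z - g z) = norm (LINT s:{real n<..}|lborel. k z s)"
      by (simp add: norm_minus_commute)
    also have "\<dots> \<le> (LINT s:{real n<..}|lborel. norm (k z s))"
      by (rule set_integral_norm_bound[OF i(1)])
    also have "\<dots> \<le> (LINT s:{real n<..}|lborel. exp (2 * (norm z)\<^sup>2 + 1/2) * exp (- s))"
      by (rule set_integral_mono[OF set_integrable_norm[OF i(1)]])
        (use ie Lambda_integrand_le[of _ z] in \<open>auto simp: k_def\<close>)
    also have "\<dots> = exp (2 * (norm z)\<^sup>2 + 1/2) * (LINT s:{real n<..}|lborel. exp (- s))"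
      by simp
    also have "(LINT s:{real n<..}|lborel. exp (- s)) = (LINT s:{0..}|lborel. exp (- s)) - L n"
      unfolding L_def split by (subst set_integral_Un[OF _ ie(2,1)]) auto
    finally show ?thesis .
  qed
  have "g holomorphic_on UNIV"
  proof (rule holomorphic_uniform_sequence)
    show "f n holomorphic_on UNIV" for n
    proof -
      have "(\<lambda>z. integral (cbox 0 (real n)) (k z)) holomorphic_on UNIV"
      proof (rule leibniz_rule_holomorphic)
        show "((\<lambda>z. k z s) has_field_derivative - 2 * complex_of_real s * k z s) (at z within UNIV)" for z s
          unfolding k_def by (auto intro!: derivative_eq_intros)
        show "k z integrable_on cbox 0 (real n)" for z
          unfolding k_def by (intro integrable_continuous continuous_intros)
        show "continuous_on (UNIV \<times> cbox 0 (real n)) (\<lambda>(z, s). - 2 * complex_of_real s * k z s)"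
          unfolding k_def split_beta by (intro continuous_intros)
      qed auto
      moreover have "f n = (\<lambda>z. integral (cbox 0 (real n)) (k z))"
        unfolding f_def box_real
        by (rule ext, rule set_borel_integral_eq_integral) (rule set_integrable_subset[OF int]; force)
      ultimately show ?thesis by simp
    qed
    fix z :: complex
    have "uniform_limit (cball z 1) f g sequentially"
    proof (rule uniform_limitI)
      fix e :: real assume e: "e > 0"
      \<comment> \<open>Every point of the unit disc around \<open>z\<close> has modulus at most
        \<open>norm z + 1\<close>, so \<open>?C\<close> dominates the factor in \<open>fg\<close> on
        the whole disc.\<close>
      let ?C = "exp (2 * (norm z + 1)\<^sup>2 + 1/2)"
      have "(\<lambda>n. ?C * ((LINT s:{0..}|lborel. exp (- s)) - L n)) \<longlonglongrightarrow> 0"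
        using tendsto_mult_left[OF lim, of ?C] by simp
      then have "\<forall>\<^sub>F n in sequentially. ?C * ((LINT s:{0..}|lborel. exp (- s)) - L n) < e"
        using e by (rule order_tendstoD)
      then show "\<forall>\<^sub>F n in sequentially. \<forall>w\<in>cball z 1. dist (f n w) (g w) < e"
      proof eventually_elim
        case (elim n)
        show ?case
        proof
          fix w assume "w \<in> cball z 1"
          then have "norm w \<le> norm z + 1"
            using norm_triangle_ineq2[of w z] by (simp add: dist_norm norm_minus_commute)
          then have "exp (2 * (norm w)\<^sup>2 + 1/2) \<le> ?C" by (simp add: power_mono)
          \<comment> \<open>The tail is nonnegative because \<open>fg\<close> at the origin bounds a
            norm by a positive multiple of it.\<close>
          moreover have "0 \<le> (LINT s:{0..}|lborel. exp (- s)) - L n"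
            using order_trans[OF norm_ge_zero fg[of n 0]] exp_gt_zero[of "2 * (norm (0::complex))\<^sup>2 + 1/2"]
            by (simp only: zero_le_mult_iff) linarith
          ultimately have "norm (f n w - g w) \<le> ?C * ((LINT s:{0..}|lborel. exp (- s)) - L n)"
            using fg[of n w] mult_right_mono order_trans by blast
          with elim show "dist (f n w) (g w) < e" by (simp add: dist_norm)
        qed
      qed
    qed
    then show "\<exists>d>0. cball z d \<subseteq> UNIV \<and> uniform_limit (cball z d) f g sequentially"
      by (intro exI[of _ 1]) auto
  qed auto
  moreover have eq: "Lambda = (\<lambda>z. complex_of_real (2 / sqrt pi) * g z)"
    by (auto simp: Lambda_def g_def k_def)
  ultimately show ?thesis unfolding eq by (intro holomorphic_intros)
qed

section \<open>Rotation of a ray of integration\<close>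

lemma closed_segment_derivative_bound:
  fixes g f :: "complex \<Rightarrow> complex"
  assumes "\<And>z. z \<in> closed_segment a b \<Longrightarrow> (g has_field_derivative f z) (at z)"
    "\<And>z. z \<in> closed_segment a b \<Longrightarrow> norm (f z) \<le> B"
  shows "norm (g b - g a) \<le> B * norm (b - a)"
  by (rule field_differentiable_bound[of "closed_segment a b" g f])
    (use assms in \<open>auto intro: has_field_derivative_at_within\<close>)

text \<open>The arc of the usual sector contour is replaced by its chord, on which \<open>Re z > 0\<close> and the
  bound is as easy to state as on the two rays.\<close>
lemma ray_rotation:
  fixes f :: "complex \<Rightarrow> complex"
  assumes hol: "f holomorphic_on {z. 0 < Re z}" and a: "0 < \<alpha>" "\<alpha> < pi / 2"
    and bnd: "\<And>p q. 0 \<le> p \<Longrightarrow> 0 \<le> q \<Longrightarrow> 0 < p + q \<Longrightarrow>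
      norm (f (complex_of_real p + complex_of_real q * exp (\<i> * complex_of_real \<alpha>))) \<le> K * exp (- (p + q))"
  shows "(LINT \<rho>:{0<..}|lborel. f (complex_of_real \<rho>)) =
    exp (\<i> * complex_of_real \<alpha>) * (LINT \<rho>:{0<..}|lborel. f (complex_of_real \<rho> * exp (\<i> * complex_of_real \<alpha>)))"
proof -
  define e where "e = exp (\<i> * complex_of_real \<alpha>)"
  have e: "0 < Re e" "norm e = 1"
    using a by (auto simp: e_def Re_exp cos_gt_zero)
  let ?S = "{z. 0 < Re z}"
  have S: "open ?S" "convex ?S"
    by (auto simp: open_halfspace_Re_gt convex_halfspace_Re_gt)
  have cont: "continuous_on ?S f" using hol by (rule holomorphic_on_imp_continuous_on)
  \<comment> \<open>The half-plane is convex, so \<open>f\<close> has a primitive on it. Cauchy's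
    theorem then amounts to comparing endpoint values of \<open>g\<close>.\<close>
  obtain g where "\<And>z. z \<in> ?S \<Longrightarrow> (g has_field_derivative f z) (at z within ?S)"
  proof (rule holomorphic_convex_primitive[OF S(2) finite.emptyI cont])
    show "f field_differentiable at z" if "z \<in> interior ?S - {}" for z
      using that hol S(1) by (auto simp: interior_open holomorphic_on_imp_differentiable_at)
  qed auto
  then have g: "(g has_field_derivative f z) (at z)" if "0 < Re z" for z
    using that S(1) by (auto simp: at_within_open[OF _ S(1)])
  have pos: "0 < Re (complex_of_real p + complex_of_real q * e)" if "0 \<le> p" "0 \<le> q" "0 < p + q" for p q
    using that e by (cases "q = 0") (auto intro: add_nonneg_pos)
  have ray: "(LINT \<rho>:{c..d}|lborel. u * f (complex_of_real \<rho> * u)) = g (complex_of_real d * u) - g (complex_of_real c * u)"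
    if u: "0 < Re u" and cd: "0 < c" "c \<le> d" for u c d
    unfolding set_lebesgue_integral_def
  proof (rule integral_FTC_Icc[OF cd(2)])
    fix x assume x: "c \<le> x" "x \<le> d"
    then have "0 < Re (complex_of_real x * u)" using u cd by simp
    then have "(g has_field_derivative f (complex_of_real x * u)) (at (complex_of_real x * u))" by (rule g)
    moreover have "((\<lambda>x. complex_of_real x * u) has_vector_derivative u) (at x)"
      by (auto simp: has_vector_derivative_def scaleR_conv_of_real intro!: derivative_eq_intros)
    ultimately have "(g \<circ> (\<lambda>x. complex_of_real x * u) has_vector_derivative u * f (complex_of_real x * u)) (at x)"
      by (rule field_vector_diff_chain_at[rotated])
    then show "((\<lambda>x. g (complex_of_real x * u)) has_vector_derivative u * f (complex_of_real x * u)) (at x within {c..d})"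
      by (simp add: o_def has_vector_derivative_at_within)
  next
    show "continuous_on {c..d} (\<lambda>\<rho>. u * f (complex_of_real \<rho> * u))"
      using u cd by (intro continuous_intros continuous_on_compose2[OF cont]) auto
  qed
  have chord: "norm (g (complex_of_real R * e) - g (complex_of_real R)) \<le> K * exp (- R) * (2 * R)" if R: "0 < R" for R
  proof -
    have z: "0 < Re z \<and> norm (f z) \<le> K * exp (- R)" if "z \<in> closed_segment (complex_of_real R) (complex_of_real R * e)" for z
    proof -
      from that obtain v where v: "0 \<le> v" "v \<le> 1" "z = (1 - v) *\<^sub>R complex_of_real R + v *\<^sub>R (complex_of_real R * e)"
        by (auto simp: closed_segment_def)
      have zz: "z = complex_of_real ((1 - v) * R) + complex_of_real (v * R) * e"
        by (simp add: v scaleR_conv_of_real)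
      \<comment> \<open>A point of the chord has \<open>p = (1 - v) * R\<close> and
        \<open>q = v * R\<close>, so \<open>p + q = R\<close> and the bound is constant along the
        chord.\<close>
      have nn: "0 \<le> (1 - v) * R" "0 \<le> v * R" and s: "(1 - v) * R + v * R = R" using v R by (auto simp: algebra_simps)
      then show ?thesis using bnd[OF nn] pos[OF nn] R unfolding s zz e_def[symmetric] by blast
    qed
    have "norm (g (complex_of_real R * e) - g (complex_of_real R)) \<le> K * exp (- R) * norm (complex_of_real R * e - complex_of_real R)"
      by (rule closed_segment_derivative_bound[where f=f]) (use z g in auto)
    also have "\<dots> \<le> K * exp (- R) * (2 * R)"
    proof (rule mult_left_mono)
      show "norm (complex_of_real R * e - complex_of_real R) \<le> 2 * R"
        using norm_triangle_ineq4[of "complex_of_real R * e" "complex_of_real R"] R e by (simp add: norm_mult)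
      show "0 \<le> K * exp (- R)" using z[of "complex_of_real R"] norm_ge_zero order_trans ends_in_segment(1) by blast
    qed
    finally show ?thesis .
  qed
  \<comment> \<open>The origin lies on the boundary of the half-plane, so the compact intervals
    approach 0 as well as infinity. \<open>Suc\<close> avoids the default
    \<open>inverse 0 = 0\<close>.\<close>
  define A where "A = (\<lambda>n::nat. {inverse (real (Suc n))..real (Suc n)})"
  have A: "incseq A" "(\<Union>n. A n) = {0<..}"
  proof -
    show "incseq A"
      unfolding A_def incseq_def by (auto intro: order_trans[OF le_imp_inverse_le])
    have "\<exists>n. x \<in> A n" if x: "0 < x" for x :: real
    proof -
      obtain n where n: "inverse (real (Suc n)) < x" using reals_Archimedean[OF x] by blast
      obtain m where m: "x \<le> real m" using real_arch_simple by blast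
      have "x \<in> A (max n m)"
        using n m by (auto simp: A_def max_def intro: order_trans[OF _ less_imp_le[OF n]] le_imp_inverse_le)
      then show ?thesis ..
    qed
    moreover have "0 < x" if "x \<in> A n" for x n
      using that unfolding A_def by (auto intro: less_le_trans[of 0 "inverse (real (Suc n))"])
    ultimately show "(\<Union>n. A n) = {0<..}" by auto
  qed
  have int: "set_integrable lborel {0<..} (\<lambda>\<rho>. f (complex_of_real \<rho> * u))" 
    if u: "u = 1 \<or> u = e" for u
  proof (rule set_integrable_bound)
    show "set_integrable lborel {0<..} (\<lambda>\<rho>::real. K * exp (- \<rho>))"
      by (rule set_integrable_mult_right, rule set_integrable_subset[OF set_integrable_exp_minus]) auto
    have "continuous_on {0<..} (\<lambda>\<rho>. f (complex_of_real \<rho> * u))"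
      using u e by (intro continuous_intros continuous_on_compose2[OF cont]) auto
    then show "set_borel_measurable lborel {0<..} (\<lambda>\<rho>. f (complex_of_real \<rho> * u))"
      unfolding set_borel_measurable_def by (auto simp: borel_measurable_continuous_on_indicator)
    have "norm (f (complex_of_real \<rho> * u)) \<le> K * exp (- \<rho>)" if "0 < \<rho>" for \<rho>
      using u bnd[of \<rho> 0] bnd[of 0 \<rho>] that by (auto simp: e_def)
    then show "AE \<rho> in lborel. \<rho> \<in> {0<..} \<longrightarrow> norm (f (complex_of_real \<rho> * u)) \<le> norm (K * exp (- \<rho>))"
      by (intro AE_I2 impI) (force intro: order_trans)
  qed
  have lim: "(\<lambda>n. LINT \<rho>:A n|lborel. f (complex_of_real \<rho> * u)) \<longlonglongrightarrow> (LINT \<rho>:{0<..}|lborel. f (complex_of_real \<rho> * u))"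
    if u: "u = 1 \<or> u = e" for u
    unfolding A(2)[symmetric] by (rule set_integral_cont_up) (use A int[OF u] in \<open>auto simp: A_def\<close>)
  \<comment> \<open>This bound on the contribution of the chord at radius \<open>R\<close> vanishes
    at both ends: by the length factor as \<open>R\<close> tends to 0, and by the exponential as
    \<open>R\<close> tends to infinity.\<close>
  let ?h = "\<lambda>R::real. K * exp (- R) * (2 * R)"
  let ?d = "\<lambda>n. (LINT \<rho>:A n|lborel. f (complex_of_real \<rho> * 1)) - e * (LINT \<rho>:A n|lborel. f (complex_of_real \<rho> * e))"
  have "?d \<longlonglongrightarrow> 0"
  proof (rule Lim_null_comparison)
    show "\<forall>\<^sub>F n in sequentially. norm (?d n) \<le> ?h (inverse (real (Suc n))) + ?h (real (Suc n))"
    proof (rule always_eventually, rule allI)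
      fix n
      let ?c = "inverse (real (Suc n))" and ?b = "real (Suc n)"
      have cb: "0 < ?c" "?c \<le> ?b" by (auto simp: field_simps)
      \<comment> \<open>The four endpoint values of \<open>g\<close> are regrouped by radius, which
        leaves exactly the inner and the outer chord.\<close>
      have "?d n = (g (complex_of_real ?c * e) - g (complex_of_real ?c)) - (g (complex_of_real ?b * e) - g (complex_of_real ?b))"
        using ray[OF _ cb, of 1] ray[OF e(1) cb] by (simp add: A_def del: of_nat_Suc)
      also have "norm \<dots> \<le> ?h ?c + ?h ?b"
        by (rule order_trans[OF norm_triangle_ineq4]) (intro add_mono chord; simp)
      finally show "norm (?d n) \<le> ?h ?c + ?h ?b" .
    qed
    have "isCont ?h 0" by (intro continuous_intros)
    from isCont_tendsto_compose[OF this LIMSEQ_inverse_real_of_nat]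
    have "(\<lambda>n. ?h (inverse (real (Suc n)))) \<longlonglongrightarrow> 0" by simp
    moreover have "(\<lambda>n. ?h (real (Suc n))) \<longlonglongrightarrow> 0"
    proof -
      have "((\<lambda>x::real. x ^ 1 / exp x) \<longlongrightarrow> 0) at_top" by (rule tendsto_power_div_exp_0)
      from filterlim_compose[OF this filterlim_real_sequentially, THEN LIMSEQ_Suc]
      have "(\<lambda>n. real (Suc n) / exp (real (Suc n))) \<longlonglongrightarrow> 0" by simp
      from tendsto_mult_right[OF this, of "2 * K"] show ?thesis
        by (simp add: exp_minus field_simps del: of_nat_Suc)
    qed
    ultimately show "(\<lambda>n. ?h (inverse (real (Suc n))) + ?h (real (Suc n))) \<longlonglongrightarrow> 0"
      using tendsto_add by fastforce
  qed
  moreover have "?d \<longlonglongrightarrow> (LINT \<rho>:{0<..}|lborel. f (complex_of_real \<rho> * 1)) - e * (LINT \<rho>:{0<..}|lborel. f (complex_of_real \<rho> * e))"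
    by (intro tendsto_intros lim) auto
  ultimately have "(LINT \<rho>:{0<..}|lborel. f (complex_of_real \<rho> * 1)) - e * (LINT \<rho>:{0<..}|lborel. f (complex_of_real \<rho> * e)) = 0"
    using LIMSEQ_unique by blast
  then show ?thesis by (simp add: e_def)
qed

section \<open>The polar chart and the angle on \<open>Omega\<close>\<close>

lemma polar_domD:
  assumes "q \<in> polar_dom"
  shows "0 < fst q" "- pi / 2 < snd q" "snd q < 3 * pi / 2"
  using assms by (auto simp: polar_dom_def)

lemma norm_polar_pt: "norm (polar_pt q) = \<bar>fst q\<bar>"
  by (simp add: polar_pt_def norm_Pair power_mult_distrib distrib_left[symmetric] real_sqrt_mult)

text \<open>\<open>Arg\<close> takes values in the half-open interval from \<open>- pi\<close> to
  \<open>pi\<close>. An angle above \<open>pi\<close> therefore comes back lowered by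
  \<open>2 * pi\<close>, falls below \<open>- pi / 2\<close>, and is restored by the case split in
  \<open>polar_angle\<close>.\<close>

lemma polar_angle_polar_pt:
  assumes q: "q \<in> polar_dom"
  shows "polar_angle (polar_pt q) = snd q"
proof -
  note d = polar_domD[OF q]
  have z: "Complex (fst (polar_pt q)) (snd (polar_pt q)) = rcis (fst q) \<psi>" 
    if "cos \<psi> = cos (snd q)" "sin \<psi> = sin (snd q)" for \<psi>
    using that by (simp add: polar_pt_def complex_eq_iff)
  show ?thesis
  proof (cases "snd q \<le> pi")
    case True
    have "Arg (Complex (fst (polar_pt q)) (snd (polar_pt q))) = snd q"
      by (rule Arg_unique'[OF d(1) _ z]) (use True d in auto)
    then show ?thesis using d by (simp add: polar_angle_def Let_def)
  next
    case False
    have "Arg (Complex (fst (polar_pt q)) (snd (polar_pt q))) = snd q - 2 * pi"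
      by (rule Arg_unique'[OF d(1) _ z]) (use False d in \<open>auto simp: cos_diff sin_diff\<close>)
    then show ?thesis using d False by (simp add: polar_angle_def Let_def)
  qed
qed

lemma polar_pt_in_Omega:
  assumes q: "q \<in> polar_dom"
  shows "polar_pt q \<in> Omega"
proof -
  note d = polar_domD[OF q]
  \<comment> \<open>In the window the cosine vanishes only at \<open>pi / 2\<close>, where the sine
    is 1: on the left it is positive, on the right negative.\<close>
  have False if c: "cos (snd q) = 0" and s: "sin (snd q) \<le> 0"
  proof (cases "snd q < pi / 2")
    case True
    then show False using cos_gt_zero_pi[of "snd q"] d c by simp
  next
    case False
    show False
    proof (cases "snd q = pi / 2")
      case True
      then have "sin (snd q) = 1" by (simp only: sin_pi_half)
      with s show False by simp
    next
      case False
      then show False using cos_gt_zero_pi[of "snd q - pi"] d c \<open>\<not> snd q < pi / 2\<close> by (simp add: cos_diff)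
    qed
  qed
  then show ?thesis using d by (auto simp: Omega_def polar_pt_def mult_le_0_iff)
qed

lemma open_Omega: "open Omega"
proof -
  have "closed {p :: real \<times> real. fst p = 0 \<and> snd p \<le> 0}"
    by (intro closed_Collect_conj closed_Collect_eq closed_Collect_le continuous_intros)
  then show ?thesis by (simp add: Omega_def open_Diff)
qed

lemma Omega_not_nonpos:
  assumes "p \<in> Omega"
  shows "Complex (snd p) (- fst p) \<notin> \<real>\<^sub>\<le>\<^sub>0"
  using assms by (auto simp: Omega_def complex_nonpos_Reals_iff)

text \<open>A quarter turn (multiplication by \<open>- \<i>\<close>) carries the slit to the branch
  cut of \<open>Arg\<close>. This replaces the case split by an expression that is visibly
  continuous on \<open>Omega\<close>.\<close>

lemma polar_angle_eq_Arg:
  assumes p: "p \<in> Omega"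
  shows "polar_angle p = Arg (Complex (snd p) (- fst p)) + pi / 2"
proof -
  let ?z = "Complex (snd p) (- fst p)"
  have nz: "norm p > 0" using p by (auto simp: Omega_def)
  have nrm: "norm ?z = norm p" by (cases p) (simp add: norm_Pair cmod_def)
  have "Arg ?z \<noteq> pi"
    using Omega_not_nonpos[OF p] Arg_eq_pi[of ?z] by (auto simp: complex_nonpos_Reals_iff)
  then have "(norm p, Arg ?z + pi / 2) \<in> polar_dom"
    using nz Arg_bounded[of ?z] by (auto simp: polar_dom_def)
  moreover have "polar_pt (norm p, Arg ?z + pi / 2) = p"
  proof -
    have "?z = rcis (norm p) (Arg ?z)" using rcis_cmod_Arg[of ?z] nrm by simp
    then have "snd p = norm p * cos (Arg ?z)" "- fst p = norm p * sin (Arg ?z)"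
      by (auto simp: complex_eq_iff)
    then show ?thesis by (simp add: polar_pt_def cos_add sin_add prod_eq_iff)
  qed
  ultimately show ?thesis using polar_angle_polar_pt[of "(norm p, Arg ?z + pi / 2)"] by simp
qed

lemma continuous_on_polar_angle: "continuous_on Omega polar_angle"
proof -
  have "continuous_on Omega (\<lambda>p. Arg (Complex (snd p) (- fst p)) + pi / 2)"
    using Omega_not_nonpos unfolding Complex_eq by (intro continuous_intros) auto
  then show ?thesis
    by (rule continuous_on_eq) (simp add: polar_angle_eq_Arg)
qed

section \<open>Integrability and Fubini on the polar domain\<close>

lemma set_integrable_exp_minus_polar_dom:
  "set_integrable lborel polar_dom (\<lambda>q. exp (- fst q))"
proof -
  have 1: "set_integrable lborel {0<..} (\<lambda>s::real. exp (- s))"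
    by (rule set_integrable_subset[OF set_integrable_exp_minus]) auto
  have 2: "set_integrable lborel {-pi/2<..<3*pi/2} (\<lambda>s::real. 1 :: real)"
    by (simp add: set_integrable_def)
  have "integrable (lborel \<Otimes>\<^sub>M lborel) (\<lambda>q :: real \<times> real. (indicat_real {0<..} (fst q) *\<^sub>R exp (- fst q)) * (indicat_real {-pi/2<..<3*pi/2} (snd q) *\<^sub>R 1))"
  proof (rule lborel_pair.Fubini_integrable)
    show "integrable lborel (\<lambda>x::real. LINT y|lborel. norm ((indicat_real {0<..} (fst (x, y)) *\<^sub>R exp (- fst (x, y))) * (indicat_real {-pi/2<..<3*pi/2} (snd (x, y)) *\<^sub>R 1)))"
    proof -
      have eq: "(\<lambda>x::real. LINT y|lborel. norm ((indicat_real {0<..} (fst (x, y)) *\<^sub>R exp (- fst (x, y))) * (indicat_real {-pi/2<..<3*pi/2} (snd (x, y)) *\<^sub>R 1)))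
        = (\<lambda>x. (indicat_real {0<..} x *\<^sub>R exp (- x)) * (LINT y|lborel. indicat_real {-pi/2<..<3*pi/2} y))"
        by (rule ext) (simp add: abs_mult)
      show ?thesis
        unfolding eq by (rule integrable_mult_left) (rule 1[unfolded set_integrable_def])
    qed
    show "AE x::real in lborel. integrable lborel (\<lambda>y::real. (indicat_real {0<..} (fst (x, y)) *\<^sub>R exp (- fst (x, y))) * (indicat_real {-pi/2<..<3*pi/2} (snd (x, y)) *\<^sub>R 1))"
      using integrable_mult_right[OF 2[unfolded set_integrable_def]] by (intro AE_I2) auto
  qed measurable
  then show "set_integrable lborel polar_dom (\<lambda>q. exp (- fst q))"
    unfolding set_integrable_def lborel_prod
    by (rule Bochner_Integration.integrable_cong[THEN iffD1, rotated -1])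
      (auto simp: polar_dom_def split: split_indicator)
qed

text \<open>The angular window is bounded, so exponential decay in the radius, uniform in the angle,
  suffices. Integrability on the original and on the rotated ray both go through this
  criterion.\<close>

lemma set_integrable_polar_dom:
  fixes g :: "real \<times> real \<Rightarrow> complex"
  assumes cont: "continuous_on polar_dom g"
    and bnd: "\<And>q. q \<in> polar_dom \<Longrightarrow> norm (g q) \<le> K * exp (- fst q)"
  shows "set_integrable lborel polar_dom g"
proof (rule set_integrable_bound)
  show "set_integrable lborel polar_dom (\<lambda>q. K * exp (- fst q))"
    by (rule set_integrable_mult_right[OF set_integrable_exp_minus_polar_dom])
  show "set_borel_measurable lborel polar_dom g"
    unfolding set_borel_measurable_def
    using borel_measurable_continuous_on_indicator[OF polar_dom_sets cont] by simp
  show "AE q in lborel. q \<in> polar_dom \<longrightarrow> norm (g q) \<le> norm (K * exp (- fst q))"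
    using bnd by (intro AE_I2 impI) (force intro: order_trans)
qed

text \<open>The order with the angle outside lets the rays be rotated one at a time. The order with
  the radius outside is that of the final formula.\<close>

lemma polar_dom_Fubini:
  fixes g :: "real \<times> real \<Rightarrow> complex"
  assumes "set_integrable lborel polar_dom g"
  shows "(LINT q:polar_dom|lborel. g q) = (LINT \<theta>:{-pi/2<..<3*pi/2}|lborel. LINT \<rho>:{0<..}|lborel. g (\<rho>, \<theta>))"
    and "(LINT q:polar_dom|lborel. g q) = (LINT \<rho>:{0<..}|lborel. LINT \<theta>:{-pi/2<..<3*pi/2}|lborel. g (\<rho>, \<theta>))"
proof -
  define k where "k = (\<lambda>\<rho> \<theta>. indicat_real {0<..} \<rho> *\<^sub>R indicat_real {-pi/2<..<3*pi/2} \<theta> *\<^sub>R g (\<rho>, \<theta>))"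
  have k: "(\<lambda>q. indicat_real polar_dom q *\<^sub>R g q) = case_prod k"
    by (auto simp: k_def polar_dom_def fun_eq_iff split: split_indicator)
  have int: "integrable (lborel \<Otimes>\<^sub>M lborel) (case_prod k)"
    using assms unfolding set_integrable_def k lborel_prod .
  have "(LINT q:polar_dom|lborel. g q) = integral\<^sup>L (lborel \<Otimes>\<^sub>M lborel) (case_prod k)"
    unfolding set_lebesgue_integral_def k lborel_prod ..
  also have "\<dots> = (LINT \<theta>|lborel. LINT \<rho>|lborel. k \<rho> \<theta>)"
    using lborel_pair.integral_snd[OF int] by simp
  also have "\<dots> = (LINT \<theta>:{-pi/2<..<3*pi/2}|lborel. LINT \<rho>:{0<..}|lborel. g (\<rho>, \<theta>))"
    unfolding set_lebesgue_integral_def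
    by (intro Bochner_Integration.integral_cong refl) (auto simp: k_def split: split_indicator)
  finally show "(LINT q:polar_dom|lborel. g q) = (LINT \<theta>:{-pi/2<..<3*pi/2}|lborel. LINT \<rho>:{0<..}|lborel. g (\<rho>, \<theta>))" .
  have "(LINT q:polar_dom|lborel. g q) = integral\<^sup>L (lborel \<Otimes>\<^sub>M lborel) (case_prod k)"
    unfolding set_lebesgue_integral_def k lborel_prod ..
  also have "\<dots> = (LINT \<rho>|lborel. LINT \<theta>|lborel. k \<rho> \<theta>)"
    using lborel_pair.integral_fst[OF int] by simp
  also have "\<dots> = (LINT \<rho>:{0<..}|lborel. LINT \<theta>:{-pi/2<..<3*pi/2}|lborel. g (\<rho>, \<theta>))"
    unfolding set_lebesgue_integral_def
    by (intro Bochner_Integration.integral_cong refl) (auto simp: k_def split: split_indicator)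
  finally show "(LINT q:polar_dom|lborel. g q) = (LINT \<rho>:{0<..}|lborel. LINT \<theta>:{-pi/2<..<3*pi/2}|lborel. g (\<rho>, \<theta>))" .
qed

section \<open>Regularity and growth of the Green's function and of \<open>F\<close>\<close>

lemma Lambda_compose_holomorphic [holomorphic_intros]:
  "f holomorphic_on S \<Longrightarrow> (\<lambda>z. Lambda (f z)) holomorphic_on S"
  using holomorphic_on_compose_gen[OF _ Lambda_holomorphic, of f S] by (simp add: o_def)

lemma Lambda_compose_continuous [continuous_intros]:
  "continuous_on S f \<Longrightarrow> continuous_on S (\<lambda>z. Lambda (f z))"
  using continuous_on_compose2[OF holomorphic_on_imp_continuous_on[OF Lambda_holomorphic]] by auto

lemma mult_pos_Re_not_nonpos:
  assumes "0 < r" "0 < Re w"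
  shows "complex_of_real r * w \<notin> \<real>\<^sub>\<le>\<^sub>0"
  using assms by (auto simp: complex_nonpos_Reals_iff mult_le_0_iff)

text \<open>The only branch cut is that of \<open>csqrt\<close>, and multiplying \<open>w\<close> by
  \<open>r > 0\<close> keeps it in the right half-plane, away from the cut.\<close>

lemma Gpolar_holomorphic:
  assumes "0 < r" "0 < t"
  shows "(\<lambda>w. Gpolar dir t r \<phi> w \<theta>) holomorphic_on {w. 0 < Re w}"
  unfolding Gpolar_def using assms mult_pos_Re_not_nonpos
  by (intro holomorphic_intros) auto

lemma Gpolar_continuous:
  fixes S :: "(real \<times> real) set"
  assumes "0 < r" "0 < t" "continuous_on S f" "continuous_on S h" "\<And>z. z \<in> S \<Longrightarrow> 0 < Re (f z)"
  shows "continuous_on S (\<lambda>z. Gpolar dir t r \<phi> (f z) (h z))"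
proof -
  have "continuous_on (- \<real>\<^sub>\<le>\<^sub>0) csqrt" by (rule continuous_on_csqrt)
  then have "continuous_on S (\<lambda>z. csqrt (complex_of_real r * f z))"
    by (rule continuous_on_compose2)
      (use assms mult_pos_Re_not_nonpos in \<open>auto intro!: continuous_intros\<close>)
  then show ?thesis
    unfolding Gpolar_def
  proof (intro continuous_intros ballI assms(3,4))
  qed (use assms(2) in auto)
qed

text \<open>Squaring removes the root, so the quadratic exponent in the bound for
  \<open>Lambda\<close> becomes linear in \<open>norm w\<close>.\<close>

lemma norm_csqrt_quotient:
  assumes "0 < r" "0 < t" "\<bar>c\<bar> \<le> 1"
  shows "(norm (csqrt (complex_of_real r * w) * complex_of_real c / csqrt (\<i> * complex_of_real t)))\<^sup>2 \<le> r * norm w / t"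
proof -
  have n: "(norm (csqrt z))\<^sup>2 = norm z" for z
    by (simp flip: norm_power)
  have "c\<^sup>2 \<le> 1" using assms(3) by (simp add: abs_square_le_1)
  then have "r * norm w * c\<^sup>2 / t \<le> r * norm w * 1 / t"
    using assms by (intro divide_right_mono mult_left_mono) auto
  then show ?thesis
    using assms by (simp add: norm_mult norm_divide power_mult_distrib power_divide n)
qed

text \<open>The only quadratic term of the exponent is \<open>- Im (w^2) / (4 * t)\<close>, from the
  free exponential. In \<open>D\<close>, the summand \<open>r / (2 * t)\<close> pays for the cross
  term of \<open>(r + w)^2\<close> and \<open>2 * r / t\<close> for the \<open>Lambda\<close>
  factors.\<close>

lemma norm_Gpolar_le:
  assumes r: "0 < r" and t: "0 < t"
  obtains C D where "0 \<le> C" "0 \<le> D"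
    "\<And>\<theta> w. norm (Gpolar dir t r \<phi> w \<theta>) \<le> C * exp (D * norm w - Im (w\<^sup>2) / (4 * t))"
proof -
  obtain K where K: "0 \<le> K" "\<And>z. norm (Lambda z) \<le> K * exp (2 * (norm z)\<^sup>2)" using Lambda_le by blast
  show thesis
  proof
    show "0 \<le> 2 * K / (8 * pi * t)" "0 \<le> r / (2 * t) + 2 * r / t" using r t K by auto
    fix \<theta> w
    have L: "norm (Lambda (csqrt (complex_of_real r * w) * complex_of_real c / csqrt (\<i> * complex_of_real t))) \<le> K * exp (2 * (r * norm w / t))"
      if "\<bar>c\<bar> \<le> 1" for c
      using norm_csqrt_quotient[OF r t that, of w] K
      by (intro order_trans[OF K(2)] mult_left_mono) auto
    let ?L1 = "Lambda (csqrt (complex_of_real r * w) * complex_of_real (cos ((\<phi> - \<theta>) / 2)) / csqrt (\<i> * complex_of_real t))"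
    let ?L2 = "Lambda (- csqrt (complex_of_real r * w) * complex_of_real (sin ((\<phi> + \<theta>) / 2)) / csqrt (\<i> * complex_of_real t))"
    have "norm (?L1 + (if dir then -1 else 1) * ?L2) \<le> norm ?L1 + norm ((if dir then -1 else 1) * ?L2)"
      by (rule norm_triangle_ineq)
    \<comment> \<open>The minus sign before the second root goes into \<open>c = - sin\<close>. The
      sign of the boundary condition has modulus one, so both cases share the bound.\<close>
    also have "\<dots> \<le> K * exp (2 * (r * norm w / t)) + K * exp (2 * (r * norm w / t))"
      using L[of "cos ((\<phi> - \<theta>) / 2)"] L[of "- sin ((\<phi> + \<theta>) / 2)"] by (intro add_mono) (auto simp: norm_mult)
    finally have l: "norm (?L1 + (if dir then -1 else 1) * ?L2) \<le> 2 * K * exp (2 * (r * norm w / t))" by simp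
    have "Re (- ((complex_of_real r + w)\<^sup>2) / (4 * \<i> * complex_of_real t)) = - (2 * r * Im w + Im (w\<^sup>2)) / (4 * t)"
    proof -
      \<comment> \<open>Since \<open>- 1 / \<i> = \<i>\<close>, the real part of the exponent is
        minus the imaginary part of the square, divided by \<open>4 * t\<close>.\<close>
      have "- ((complex_of_real r + w)\<^sup>2) / (4 * \<i> * complex_of_real t) = \<i> * (complex_of_real r + w)\<^sup>2 / complex_of_real (4 * t)"
        using t by (simp add: field_simps)
      then show ?thesis using t by (simp add: power2_eq_square Re_divide_of_real algebra_simps del: of_real_mult)
    qed
    moreover have "- (2 * r * Im w) / (4 * t) \<le> r / (2 * t) * norm w"
    proof -
      have "r / (2 * t) * (- Im w) \<le> r / (2 * t) * norm w"
        using r t abs_Im_le_cmod[of w] by (intro mult_left_mono) auto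
      then show ?thesis by (simp add: field_simps)
    qed
    ultimately have "norm (exp (- ((complex_of_real r + w)\<^sup>2) / (4 * \<i> * complex_of_real t))) \<le> exp (r / (2 * t) * norm w - Im (w\<^sup>2) / (4 * t))"
      by (simp add: norm_exp_eq_Re add_divide_distrib diff_divide_distrib)
    then have "norm (exp (- ((complex_of_real r + w)\<^sup>2) / (4 * \<i> * complex_of_real t)) / (8 * \<i> * complex_of_real pi * complex_of_real t))
       \<le> exp (r / (2 * t) * norm w - Im (w\<^sup>2) / (4 * t)) / (8 * pi * t)"
      using t by (simp add: norm_divide norm_mult divide_right_mono)
    then have "norm (Gpolar dir t r \<phi> w \<theta>) \<le> exp (r / (2 * t) * norm w - Im (w\<^sup>2) / (4 * t)) / (8 * pi * t) * (2 * K * exp (2 * (r * norm w / t)))"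
      unfolding Gpolar_def norm_mult using t l K by (intro mult_mono) auto
    also have "\<dots> = 2 * K / (8 * pi * t) * exp ((r / (2 * t) + 2 * r / t) * norm w - Im (w\<^sup>2) / (4 * t))"
    proof -
      have "(r / (2 * t) + 2 * r / t) * norm w - Im (w\<^sup>2) / (4 * t) = (r / (2 * t) * norm w - Im (w\<^sup>2) / (4 * t)) + 2 * (r * norm w / t)"
        by (simp add: algebra_simps)
      then show ?thesis by (simp only: exp_add) simp
    qed
    finally show "norm (Gpolar dir t r \<phi> w \<theta>) \<le> 2 * K / (8 * pi * t) * exp ((r / (2 * t) + 2 * r / t) * norm w - Im (w\<^sup>2) / (4 * t))" .
  qed
qed

text \<open>The derivative of \<open>F\<close> is complex linear, so along a complex line the chain
  rule yields multiplication by the single number \<open>a * c + b * s\<close>.\<close>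

lemma entire2_slice_holomorphic:
  assumes "entire2 F"
  shows "(\<lambda>w. F (w * c, w * s)) holomorphic_on S"
proof -
  have "\<exists>d. ((\<lambda>w. F (w * c, w * s)) has_field_derivative d) (at w)" for w
  proof -
    obtain a b where "(F has_derivative (\<lambda>h. a * fst h + b * snd h)) (at (w * c, w * s))"
      using assms unfolding entire2_def by blast
    moreover have "((\<lambda>w. (w * c, w * s)) has_derivative (\<lambda>h. (h * c, h * s))) (at w)"
      by (auto intro!: derivative_eq_intros)
    ultimately have "((\<lambda>w. F (w * c, w * s)) has_derivative (\<lambda>h. a * (h * c) + b * (h * s))) (at w)"
      using diff_chain_at[of "\<lambda>w. (w * c, w * s)" "\<lambda>h. (h * c, h * s)" w F] by (force simp: o_def)
    moreover have "(\<lambda>h. a * (h * c) + b * (h * s)) = (*) (a * c + b * s)"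
      by (auto simp: algebra_simps)
    ultimately show ?thesis unfolding has_field_derivative_def by auto
  qed
  then show ?thesis
    by (auto simp: holomorphic_on_def field_differentiable_def intro: has_field_derivative_at_within)
qed

lemma entire2_continuous:
  assumes "entire2 F"
  shows "continuous_on UNIV F"
  using assms unfolding entire2_def
  by (metis continuous_at_imp_continuous_on has_derivative_continuous)

text \<open>The exponent is \<open>Re (\<epsilon> w\<^sup>2) + \<kappa> Im (w\<^sup>2)\<close>: the first term decays near the positive axis and
  the second one near the rotated ray.\<close>
lemma sector_exponent_ge:
  fixes p q \<epsilon> \<kappa> m \<alpha> :: real
  defines "w \<equiv> complex_of_real p + complex_of_real q * exp (\<i> * complex_of_real \<alpha>)"
  assumes pq: "0 \<le> p" "0 \<le> q" and m: "p = 0 \<or> m \<le> \<epsilon>" "p = 0 \<or> m \<le> \<epsilon> * cos \<alpha> + \<kappa> * sin \<alpha>"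
    "q = 0 \<or> m \<le> \<epsilon> * cos (2 * \<alpha>) + \<kappa> * sin (2 * \<alpha>)"
  shows "m * (p + q)\<^sup>2 \<le> \<epsilon> * Re (w\<^sup>2) + \<kappa> * Im (w\<^sup>2)"
proof -
  have e: "exp (\<i> * complex_of_real \<alpha>) = Complex (cos \<alpha>) (sin \<alpha>)"
    by (simp add: complex_eq_iff Re_exp Im_exp)
  \<comment> \<open>With \<open>e = exp (\<i> * \<alpha>)\<close>, expanding
    \<open>w^2 = p^2 + 2 * p * q * e + q^2 * e^2\<close> reduces the claim to the coefficients of
    \<open>p^2\<close>, \<open>2 * p * q\<close> and \<open>q^2\<close>. The disjunctions drop
    vanishing terms: on the rotated ray \<open>p = 0\<close> only the last condition remains, which
    permits an \<open>m\<close> independent of \<open>\<epsilon>\<close>.\<close>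
  have "m * p\<^sup>2 \<le> \<epsilon> * p\<^sup>2" "m * (2 * p * q) \<le> (\<epsilon> * cos \<alpha> + \<kappa> * sin \<alpha>) * (2 * p * q)"
    using m pq by (cases "p = 0"; simp add: mult_right_mono)+
  moreover have "m * q\<^sup>2 \<le> (\<epsilon> * ((cos \<alpha>)\<^sup>2 - (sin \<alpha>)\<^sup>2) + \<kappa> * (2 * sin \<alpha> * cos \<alpha>)) * q\<^sup>2"
  proof (cases "q = 0")
    case False
    with m(3) have "m \<le> \<epsilon> * cos (2 * \<alpha>) + \<kappa> * sin (2 * \<alpha>)" by simp
    from mult_right_mono[OF this zero_le_power2[of q]] show ?thesis unfolding cos_double sin_double .
  qed simp
  ultimately show ?thesis
    by (simp add: w_def e power2_eq_square algebra_simps)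
qed

text \<open>Completing the square with \<open>D + 2\<close> in place of \<open>D\<close> gains
  \<open>exp (- 2 * R)\<close>: one half absorbs the factor \<open>R \<le> exp R\<close>, the other
  is the decay that remains.\<close>

lemma linear_times_gaussian_le:
  fixes D m R :: real
  assumes "0 < m" "0 \<le> R"
  shows "R * exp (D * R - m * R\<^sup>2) \<le> exp ((D + 2)\<^sup>2 / (4 * m)) * exp (- R)"
proof -
  have "0 \<le> (2 * m * R - (D + 2))\<^sup>2 / (4 * m)" using assms by simp
  then have "D * R - m * R\<^sup>2 \<le> (D + 2)\<^sup>2 / (4 * m) - 2 * R"
    using assms by (simp add: field_simps power2_eq_square)
  then have "R * exp (D * R - m * R\<^sup>2) \<le> exp R * exp ((D + 2)\<^sup>2 / (4 * m) - 2 * R)"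
  proof (intro mult_mono)
    show "R \<le> exp R" using exp_ge_add_one_self[of R] by linarith
  qed auto
  also have "\<dots> = exp ((D + 2)\<^sup>2 / (4 * m)) * exp (- R)" by (simp flip: exp_add)
  finally show ?thesis .
qed

section \<open>Rotation at fixed \<open>\<epsilon>\<close> and passage to the limit\<close>

theorem theorem2p2:
  fixes dir :: bool and F :: "complex \<times> complex \<Rightarrow> complex"
    and t :: real and x :: "real \<times> real" and \<alpha> :: real
  assumes "F \<in> A1" and "t > 0" and "x \<in> Omega" and "0 < \<alpha>" and "\<alpha> < pi / 2"
  shows "(\<forall>\<epsilon>>0. set_integrable lborel Omega
            (\<lambda>y. complex_of_real (exp (- \<epsilon> * norm y ^ 2)) * G dir t x y * F (cpair y)))
       \<and> set_integrable lborel ({0<..} \<times> {- pi / 2 <..< 3 * pi / 2})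
            (rotated_integrand dir t x F \<alpha>)
       \<and> ((\<lambda>\<epsilon>. set_lebesgue_integral lborel Omega
            (\<lambda>y. complex_of_real (exp (- \<epsilon> * norm y ^ 2)) * G dir t x y * F (cpair y)))
          \<longlongrightarrow> exp (2 * \<i> * complex_of_real \<alpha>) *
               set_lebesgue_integral lborel {0<..}
                 (\<lambda>\<rho>. set_lebesgue_integral lborel {- pi / 2 <..< 3 * pi / 2}
                    (\<lambda>\<theta>. rotated_integrand dir t x F \<alpha> (\<rho>, \<theta>))))
         (at_right 0)"
proof -
  obtain A B where F: "entire2 F" and AB: "0 \<le> A" "0 \<le> B" "\<And>z. norm (F z) \<le> A * exp (B * norm z)"
    using assms(1) unfolding A1_def by blast
  define r where "r = norm x"
  define \<kappa> where "\<kappa> = 1 / (4 * t)"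
  define e where "e = exp (\<i> * complex_of_real \<alpha>)"
  have r: "0 < r" using assms(3) by (auto simp: r_def Omega_def)
  have \<kappa>: "0 < \<kappa>" using assms(2) by (simp add: \<kappa>_def)
  have sc: "0 < sin \<alpha>" "0 < cos \<alpha>" "0 < sin (2 * \<alpha>)"
    using assms(4,5) by (auto intro: sin_gt_zero cos_gt_zero)
  have e: "0 < Re e" using sc by (simp add: e_def Re_exp)
  define kern where "kern = (\<lambda>w \<theta>. Gpolar dir t r (polar_angle x) w \<theta> *
    F (w * complex_of_real (cos \<theta>), w * complex_of_real (sin \<theta>)))"
  \<comment> \<open>The polar weight enters as the holomorphic factor \<open>w\<close>. On the
    rotated ray it equals \<open>\<rho> * e\<close>; this \<open>e\<close> and the one from the
    rotation of the ray make up the factor \<open>exp (2 * \<i> * \<alpha>)\<close>.\<close>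
  define f where "f = (\<lambda>\<epsilon> w \<theta>. exp (- (complex_of_real \<epsilon> * w\<^sup>2)) * kern w \<theta> * w)"
  obtain C1 D1 where CD1: "0 \<le> C1" "0 \<le> D1"
    "\<And>\<theta> w. norm (Gpolar dir t r (polar_angle x) w \<theta>) \<le> C1 * exp (D1 * norm w - Im (w\<^sup>2) / (4 * t))"
    using norm_Gpolar_le[OF r assms(2)] by blast
  define C where "C = C1 * A"
  define D where "D = D1 + B"
  have CD: "0 \<le> C" "0 \<le> D" using CD1 AB by (auto simp: C_def D_def)
  have kern_le: "norm (kern w \<theta>) \<le> C * exp (D * norm w - \<kappa> * Im (w\<^sup>2))" for w \<theta>
  proof -
    have "norm (w * complex_of_real (cos \<theta>), w * complex_of_real (sin \<theta>)) = norm w"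
      by (simp add: norm_Pair norm_mult power_mult_distrib distrib_left[symmetric] real_sqrt_mult)
    then have "norm (F (w * complex_of_real (cos \<theta>), w * complex_of_real (sin \<theta>))) \<le> A * exp (B * norm w)"
      using AB(3) by metis
    then have "norm (kern w \<theta>) \<le> (C1 * exp (D1 * norm w - Im (w\<^sup>2) / (4 * t))) * (A * exp (B * norm w))"
      unfolding kern_def norm_mult using CD1 by (intro mult_mono) auto
    also have "\<dots> = C * exp ((D1 * norm w - Im (w\<^sup>2) / (4 * t)) + B * norm w)"
      by (simp only: exp_add C_def) simp
    also have "(D1 * norm w - Im (w\<^sup>2) / (4 * t)) + B * norm w = D * norm w - \<kappa> * Im (w\<^sup>2)"
      by (simp add: D_def \<kappa>_def algebra_simps)
    finally show ?thesis .
  qed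
  \<comment> \<open>The rate \<open>m\<close> stays free: on the original ray and on the whole
    sector it will depend on \<open>\<epsilon>\<close>, on the rotated ray it will not.\<close>
  have f_le: "norm (f \<epsilon> (complex_of_real p + complex_of_real q * e) \<theta>) \<le> C * exp ((D + 2)\<^sup>2 / (4 * m)) * exp (- (p + q))"
    if pq: "0 \<le> p" "0 \<le> q" and m: "0 < m" "p = 0 \<or> m \<le> \<epsilon>" "p = 0 \<or> m \<le> \<epsilon> * cos \<alpha> + \<kappa> * sin \<alpha>"
      "q = 0 \<or> m \<le> \<epsilon> * cos (2 * \<alpha>) + \<kappa> * sin (2 * \<alpha>)" for \<epsilon> p q m \<theta>
  proof -
    define w where "w = complex_of_real p + complex_of_real q * e"
    have w: "norm w \<le> p + q"
      unfolding w_def using pq norm_triangle_ineq[of "complex_of_real p" "complex_of_real q * e"]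
      by (simp add: norm_mult e_def)
    have ex: "m * (p + q)\<^sup>2 \<le> \<epsilon> * Re (w\<^sup>2) + \<kappa> * Im (w\<^sup>2)"
      unfolding w_def e_def by (rule sector_exponent_ge[OF pq m(2-4)])
    have "norm (f \<epsilon> w \<theta>) = exp (- (\<epsilon> * Re (w\<^sup>2))) * norm (kern w \<theta>) * norm w"
      by (simp add: f_def norm_mult norm_exp_eq_Re)
    also have "\<dots> \<le> exp (- (\<epsilon> * Re (w\<^sup>2))) * (C * exp (D * norm w - \<kappa> * Im (w\<^sup>2))) * (p + q)"
      using w pq by (intro mult_mono mult_left_mono kern_le) (auto intro!: mult_nonneg_nonneg CD)
    also have "\<dots> = C * ((p + q) * exp (D * norm w - (\<epsilon> * Re (w\<^sup>2) + \<kappa> * Im (w\<^sup>2))))"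
      by (simp add: exp_add exp_diff exp_minus field_simps)
    also have "\<dots> \<le> C * ((p + q) * exp (D * (p + q) - m * (p + q)\<^sup>2))"
      using w ex CD pq mult_left_mono[OF w CD(2)] by (intro mult_left_mono) auto
    also have "\<dots> \<le> C * (exp ((D + 2)\<^sup>2 / (4 * m)) * exp (- (p + q)))"
      using CD pq by (intro mult_left_mono linear_times_gaussian_le m) auto
    finally show ?thesis by (simp add: w_def)
  qed
  have hol: "(\<lambda>w. f \<epsilon> w \<theta>) holomorphic_on {w. 0 < Re w}" for \<epsilon> \<theta>
    unfolding f_def kern_def
    by (intro holomorphic_intros Gpolar_holomorphic r assms(2) entire2_slice_holomorphic F)
  have cont: "continuous_on polar_dom (\<lambda>q. f \<epsilon> (complex_of_real (fst q) * u) (snd q))" if u: "0 < Re u" for \<epsilon> u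
    unfolding f_def kern_def
    by (intro continuous_intros Gpolar_continuous r assms(2) continuous_on_compose2[OF entire2_continuous[OF F]])
      (use u polar_domD(1) in auto)
  have int_real: "set_integrable lborel polar_dom (\<lambda>q. f \<epsilon> (complex_of_real (fst q)) (snd q))"
    if \<epsilon>: "0 < \<epsilon>" for \<epsilon>
  proof (rule set_integrable_polar_dom)
    show "continuous_on polar_dom (\<lambda>q. f \<epsilon> (complex_of_real (fst q)) (snd q))"
      using cont[of 1] by simp
    \<comment> \<open>On the original ray \<open>q = 0\<close>, so the condition that forces
      \<open>\<epsilon>\<close> to be small is void and every \<open>\<epsilon> > 0\<close> is
      covered.\<close>
    define m where "m = min \<epsilon> (\<epsilon> * cos \<alpha> + \<kappa> * sin \<alpha>)"
    have m: "0 < m" "m \<le> \<epsilon>" "m \<le> \<epsilon> * cos \<alpha> + \<kappa> * sin \<alpha>"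
      using \<epsilon> sc \<kappa> by (auto simp: m_def add_pos_pos)
    show "norm (f \<epsilon> (complex_of_real (fst q)) (snd q)) \<le> C * exp ((D + 2)\<^sup>2 / (4 * m)) * exp (- fst q)"
      if "q \<in> polar_dom" for q
      using f_le[of "fst q" 0 m \<epsilon> "snd q"] m polar_domD(1)[OF that] by simp
  qed
  \<comment> \<open>For \<open>\<alpha> > pi / 4\<close> the regulariser grows along the rotated
    ray. Up to this threshold it consumes at most half of the decay
    \<open>\<kappa> * sin (2 * \<alpha>)\<close>, and the other half is again
    \<open>\<epsilon>0\<close>.\<close>
  define \<epsilon>0 where "\<epsilon>0 = \<kappa> * sin (2 * \<alpha>) / 2"
  have \<epsilon>0: "0 < \<epsilon>0" using sc \<kappa> by (simp add: \<epsilon>0_def)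
  have small: "\<epsilon>0 \<le> \<epsilon> * cos (2 * \<alpha>) + \<kappa> * sin (2 * \<alpha>)" if "0 \<le> \<epsilon>" "\<epsilon> \<le> \<epsilon>0" for \<epsilon>
  proof -
    have "\<epsilon> * (- cos (2 * \<alpha>)) \<le> \<epsilon> * 1" using that by (intro mult_left_mono) auto
    then show ?thesis using that by (simp add: \<epsilon>0_def)
  qed
  define M where "M = C * exp ((D + 2)\<^sup>2 / (4 * \<epsilon>0))"
  \<comment> \<open>\<open>M\<close> is independent of \<open>\<epsilon>\<close> and the value
    \<open>\<epsilon> = 0\<close> is included: this is the majorant for dominated convergence and
    also gives absolute convergence of the limit integral.\<close>
  have f_rot_le: "norm (f \<epsilon> (complex_of_real \<rho> * e) \<theta>) \<le> M * exp (- \<rho>)" 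
    if "0 \<le> \<epsilon>" "\<epsilon> \<le> \<epsilon>0" "0 < \<rho>" for \<epsilon> \<rho> \<theta>
    using f_le[of 0 \<rho> \<epsilon>0 \<epsilon> \<theta>] that small \<epsilon>0 by (simp add: M_def)
  have int_rot: "set_integrable lborel polar_dom (\<lambda>q. f \<epsilon> (complex_of_real (fst q) * e) (snd q))"
    if "0 \<le> \<epsilon>" "\<epsilon> \<le> \<epsilon>0" for \<epsilon>
    by (rule set_integrable_polar_dom[where K = M])
      (use that e cont f_rot_le polar_domD(1) in auto)
  \<comment> \<open>\<open>f 0\<close> carries the weight \<open>\<rho> * e\<close> where
    \<open>rotated_integrand\<close> carries \<open>\<rho>\<close>, hence the compensating
    phase.\<close>
  have rot: "rotated_integrand dir t x F \<alpha> q = exp (- (\<i> * complex_of_real \<alpha>)) * f 0 (complex_of_real (fst q) * e) (snd q)" for q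
    by (simp add: rotated_integrand_def Let_def f_def kern_def e_def r_def exp_minus)
  let ?u = "\<lambda>\<epsilon> y. complex_of_real (exp (- \<epsilon> * norm y ^ 2)) * G dir t x y * F (cpair y)"
  have u_polar: "fst q *\<^sub>R (indicat_real Omega (polar_pt q) *\<^sub>R ?u \<epsilon> (polar_pt q)) = f \<epsilon> (complex_of_real (fst q)) (snd q)"
    if q: "q \<in> polar_dom" for q \<epsilon>
  proof -
    have "norm (polar_pt q) = fst q" using polar_domD(1)[OF q] by (simp add: norm_polar_pt)
    moreover have "cpair (polar_pt q) = (complex_of_real (fst q) * complex_of_real (cos (snd q)), complex_of_real (fst q) * complex_of_real (sin (snd q)))"
      by (simp add: cpair_def polar_pt_def)
    ultimately show ?thesis
      using polar_pt_in_Omega[OF q] polar_angle_polar_pt[OF q]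
      by (simp add: f_def kern_def G_def r_def scaleR_conv_of_real flip: exp_of_real)
  qed
  have u_meas: "(\<lambda>y. indicat_real Omega y *\<^sub>R ?u \<epsilon> y) \<in> borel_measurable borel" for \<epsilon>
  proof (rule borel_measurable_continuous_on_indicator)
    show "Omega \<in> sets borel" using open_Omega by (rule borel_open)
    have "continuous_on Omega (\<lambda>y. G dir t x y)"
      unfolding G_def
      by (rule Gpolar_continuous) (use r assms(2) continuous_on_polar_angle in \<open>auto simp: r_def Omega_def intro!: continuous_intros\<close>)
    moreover have "continuous_on Omega (\<lambda>y. F (cpair y))"
      unfolding cpair_def
      by (intro continuous_intros continuous_on_compose2[OF entire2_continuous[OF F]]) auto
    ultimately show "continuous_on Omega (?u \<epsilon>)" by (intro continuous_intros)
  qed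
  have u_int: "set_integrable lborel Omega (?u \<epsilon>) \<longleftrightarrow> set_integrable lborel polar_dom (\<lambda>q. f \<epsilon> (complex_of_real (fst q)) (snd q))" for \<epsilon>
  proof -
    have "set_integrable lborel Omega (?u \<epsilon>) \<longleftrightarrow> set_integrable lborel polar_dom (\<lambda>q. fst q *\<^sub>R (indicat_real Omega (polar_pt q) *\<^sub>R ?u \<epsilon> (polar_pt q)))"
      using polar_integral(1)[OF u_meas[of \<epsilon>]] by (simp only: set_integrable_def)
    also have "\<dots> \<longleftrightarrow> set_integrable lborel polar_dom (\<lambda>q. f \<epsilon> (complex_of_real (fst q)) (snd q))"
      by (rule set_integrable_cong[OF refl refl u_polar])
    finally show ?thesis .
  qed
  have u_eq: "(LINT y:Omega|lborel. ?u \<epsilon> y) = (LINT q:polar_dom|lborel. f \<epsilon> (complex_of_real (fst q)) (snd q))" for \<epsilon>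
  proof -
    have "(LINT y:Omega|lborel. ?u \<epsilon> y) = (LINT q:polar_dom|lborel. fst q *\<^sub>R (indicat_real Omega (polar_pt q) *\<^sub>R ?u \<epsilon> (polar_pt q)))"
      using polar_integral(2)[OF u_meas[of \<epsilon>]] by (simp only: set_lebesgue_integral_def)
    also have "\<dots> = (LINT q:polar_dom|lborel. f \<epsilon> (complex_of_real (fst q)) (snd q))"
      by (rule set_lebesgue_integral_cong) (use u_polar in auto)
    finally show ?thesis .
  qed
  have rotate: "(LINT y:Omega|lborel. ?u \<epsilon> y) = e * (LINT q:polar_dom|lborel. f \<epsilon> (complex_of_real (fst q) * e) (snd q))"
    if \<epsilon>: "0 < \<epsilon>" "\<epsilon> \<le> \<epsilon>0" for \<epsilon>
  proof -
    \<comment> \<open>On the whole sector all three coefficients count. That \<open>m\<close>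
      shrinks with \<open>\<epsilon>\<close> is harmless, since the rotation takes place at fixed
      \<open>\<epsilon>\<close>.\<close>
    define m where "m = Min {\<epsilon>, \<epsilon> * cos \<alpha> + \<kappa> * sin \<alpha>, \<epsilon>0}"
    have m: "0 < m" "m \<le> \<epsilon>" "m \<le> \<epsilon> * cos \<alpha> + \<kappa> * sin \<alpha>" "m \<le> \<epsilon>0"
      using \<epsilon> sc \<kappa> \<epsilon>0 by (auto simp: m_def add_pos_pos)
    have "(LINT y:Omega|lborel. ?u \<epsilon> y) = (LINT \<theta>:{-pi/2<..<3*pi/2}|lborel. LINT \<rho>:{0<..}|lborel. f \<epsilon> (complex_of_real \<rho>) \<theta>)"
      unfolding u_eq polar_dom_Fubini(1)[OF int_real[OF \<epsilon>(1)]] by simp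
    also have "\<dots> = (LINT \<theta>:{-pi/2<..<3*pi/2}|lborel. e * (LINT \<rho>:{0<..}|lborel. f \<epsilon> (complex_of_real \<rho> * e) \<theta>))"
    proof -
      have "(LINT \<rho>:{0<..}|lborel. f \<epsilon> (complex_of_real \<rho>) \<theta>) = e * (LINT \<rho>:{0<..}|lborel. f \<epsilon> (complex_of_real \<rho> * e) \<theta>)" for \<theta>
      proof (rule ray_rotation[OF hol assms(4,5), folded e_def])
        show "norm (f \<epsilon> (complex_of_real p + complex_of_real q * e) \<theta>) \<le> C * exp ((D + 2)\<^sup>2 / (4 * m)) * exp (- (p + q))"
          if "0 \<le> p" "0 \<le> q" for p q
          by (rule f_le[OF that m(1)]) (use m small[of \<epsilon>] \<epsilon> in auto)
      qed
      then show ?thesis by simp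
    qed
    also have "\<dots> = e * (LINT q:polar_dom|lborel. f \<epsilon> (complex_of_real (fst q) * e) (snd q))"
      using polar_dom_Fubini(1)[OF int_rot[of \<epsilon>]] \<epsilon> by simp
    finally show ?thesis .
  qed
  \<comment> \<open>Writing \<open>\<epsilon> = inverse s\<close> turns the right-hand limit at 0
    into a limit at infinity, to which dominated convergence applies.\<close>
  have lim: "((\<lambda>\<epsilon>. LINT q:polar_dom|lborel. f \<epsilon> (complex_of_real (fst q) * e) (snd q))
    \<longlongrightarrow> (LINT q:polar_dom|lborel. f 0 (complex_of_real (fst q) * e) (snd q))) (at_right 0)"
    unfolding filterlim_at_right_to_top set_lebesgue_integral_def
  proof (rule integral_dominated_convergence_at_top)
    let ?g = "\<lambda>\<epsilon> q. indicat_real polar_dom q *\<^sub>R f \<epsilon> (complex_of_real (fst q) * e) (snd q)"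
    show meas: "?g \<epsilon> \<in> borel_measurable lborel" for \<epsilon>
      using borel_measurable_continuous_on_indicator[OF polar_dom_sets cont[OF e]] by simp
    show "?g (inverse s) \<in> borel_measurable lborel" for s by (rule meas)
    show "integrable lborel (\<lambda>q. indicat_real polar_dom q *\<^sub>R (M * exp (- fst q)))"
      by (rule set_integrable_mult_right[OF set_integrable_exp_minus_polar_dom, unfolded set_integrable_def])
    show "\<forall>\<^sub>F s in at_top. AE q in lborel. norm (?g (inverse s) q) \<le> indicat_real polar_dom q *\<^sub>R (M * exp (- fst q))"
      using eventually_ge_at_top[of "inverse \<epsilon>0"]
    proof eventually_elim
      case (elim s)
      then have s: "0 \<le> inverse s" "inverse s \<le> \<epsilon>0"
        using \<epsilon>0 le_imp_inverse_le[OF elim] by (auto simp: less_le_trans[of 0 "inverse \<epsilon>0"] intro: order_trans[of 0 "inverse \<epsilon>0"])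
      show ?case
        using f_rot_le[OF s] polar_domD(1) by (intro AE_I2) (auto split: split_indicator)
    qed
    show "AE q in lborel. ((\<lambda>s. ?g (inverse s) q) \<longlongrightarrow> ?g 0 q) at_top"
    proof (rule AE_I2)
      fix q :: "real \<times> real"
      have "((\<lambda>\<epsilon>. ?g \<epsilon> q) \<longlongrightarrow> ?g 0 q) (at_right 0)"
        unfolding f_def by (intro tendsto_intros)
      then show "((\<lambda>s. ?g (inverse s) q) \<longlongrightarrow> ?g 0 q) at_top"
        unfolding filterlim_at_right_to_top .
    qed
  qed
  have "((\<lambda>\<epsilon>. LINT y:Omega|lborel. ?u \<epsilon> y) \<longlongrightarrow> e * (LINT q:polar_dom|lborel. f 0 (complex_of_real (fst q) * e) (snd q))) (at_right 0)"
  proof (rule Lim_transform_eventually)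
    show "((\<lambda>\<epsilon>. e * (LINT q:polar_dom|lborel. f \<epsilon> (complex_of_real (fst q) * e) (snd q)))
      \<longlongrightarrow> e * (LINT q:polar_dom|lborel. f 0 (complex_of_real (fst q) * e) (snd q))) (at_right 0)"
      by (intro tendsto_intros lim)
    \<comment> \<open>The rotation identity holds up to \<open>\<epsilon>0\<close>, and the limit
      sees only such values.\<close>
    have "\<forall>\<^sub>F \<epsilon> in at_right 0. 0 < \<epsilon> \<and> \<epsilon> < \<epsilon>0"
      using eventually_at_right_real[OF \<epsilon>0] by simp
    then show "\<forall>\<^sub>F \<epsilon> in at_right 0. e * (LINT q:polar_dom|lborel. f \<epsilon> (complex_of_real (fst q) * e) (snd q)) = (LINT y:Omega|lborel. ?u \<epsilon> y)"
      by (rule eventually_mono) (rule rotate[symmetric]; simp)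
  qed
  moreover have int_R: "set_integrable lborel polar_dom (rotated_integrand dir t x F \<alpha>)"
    unfolding rot[abs_def] using int_rot[of 0] \<epsilon>0 by simp
  moreover have "e * (LINT q:polar_dom|lborel. f 0 (complex_of_real (fst q) * e) (snd q))
    = exp (2 * \<i> * complex_of_real \<alpha>) * (LINT q:polar_dom|lborel. rotated_integrand dir t x F \<alpha> q)"
    unfolding rot by (simp add: e_def mult.assoc[symmetric] flip: exp_add)
  ultimately show ?thesis
    unfolding polar_dom_Fubini(2)[OF int_R] using u_int int_real by (auto simp: polar_dom_def)
qed

end
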